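(* Let $X\in\mathbb{R}^{n\times p}$ be a matrix all of whose columns have unit Euclidean norm, and let $\epsilon\in(0,1)$. Let $R$ be a positive integer satisfying $$R\log R\;\le\;\frac{\epsilon^2}{4(1+\epsilon)}\,\frac{p}{\|X\|^2}.$$ Then there exists a subset $T\subset\{1,\dots,p\}$ with $|T|\ge R$ such that $$1-\epsilon\;\le\;\lambda_{\min}(X_T^tX_T)\;\le\;\lambda_{\max}(X_T^tX_T)\;\le\;1+\epsilon.$$
   Context: $\|X\|$ denotes the operator norm of $X$ (from $\ell_2$ to $\ell_2$), and $\log$ is the natural logarithm. For $T\subset\{1,\dots,p\}$, $X_T$ is the $n\times|T|$ submatrix of $X$ formed by the columns indexed by $T$. For a real symmetric matrix $A$, $\lambda_{\min}(A)$ and $\lambda_{\max}(A)$ denote its smallest and largest eigenvalues. *)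

theory Defs
  imports Complex_Main "Jordan_Normal_Form.DL_Submatrix" "Jordan_Normal_Form.Char_Poly"
begin

definition vnorm :: "real vec \<Rightarrow> real" where
  "vnorm v = sqrt (v \<bullet> v)"

definition op_norm :: "real mat \<Rightarrow> real" where
  "op_norm X = Sup {vnorm (X *\<^sub>v v) | v. v \<in> carrier_vec (dim_col X) \<and> vnorm v = 1}"

definition lambda_min :: "real mat \<Rightarrow> real" where
  "lambda_min A = Min {k. eigenvalue A k}"

definition lambda_max :: "real mat \<Rightarrow> real" where
  "lambda_max A = Max {k. eigenvalue A k}"

text \<open>Column submatrix X_T (columns indexed by T, 0-based indices).\<close>
definition col_submatrix :: "real mat \<Rightarrow> nat set \<Rightarrow> real mat" where
  "col_submatrix X T = submatrix X UNIV T"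

end

theory Submission
  imports Defs "Jordan_Normal_Form.Spectral_Radius"
begin

text \<open>
  Write \<open>H = G - 1\<close> for the off-diagonal part of the Gram matrix of the selected columns and
  \<open>N = op_norm X\<^sup>2\<close>. Columns are selected one at a time. For a level \<open>b\<close> that grows linearly from
  \<open>2\<epsilon>/3\<close> to \<open>\<epsilon>\<close>, both \<open>b - H\<close> and \<open>b + H\<close> are kept positive definite, and the potential
  \<open>S = tr (b - H)\<^sup>-\<^sup>1 + tr (b + H)\<^sup>-\<^sup>1\<close> is kept at most \<open>15 r / (4\<epsilon>)\<close> after \<open>r\<close> steps. Appending a column
  borders \<open>H\<close> by the vector \<open>v\<close> of inner products with the columns selected so far; by the Schur
  complement the potential then changes by an expression in \<open>v\<^sup>T (b \<plusminus> H)\<^sup>-\<^sup>1 v\<close> and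
  \<open>v\<^sup>T (b \<plusminus> H)\<^sup>-\<^sup>2 v\<close>, whose averages over all columns are at most \<open>(1 + b) N / p\<close> times the
  corresponding traces. The loss caused by the second powers is paid for by the increase of \<open>b\<close>.
  This requires \<open>R N (1 + \<epsilon>) \<le> 4 \<epsilon>\<^sup>2 p / 27\<close>, which the hypothesis provides as soon as \<open>ln R \<ge> 27/16\<close>,
  in particular for \<open>R \<ge> 8\<close>. For \<open>R < 8\<close> one selects greedily with respect to the Frobenius norm of \<open>H\<close>,
  which works because then \<open>R - 1 \<le> 4 ln R\<close>.
\<close>

subsection \<open>Positive inverses and bordering\<close>

text \<open>Matrices are functions restricted to an index set, so appending a column is just
  \<open>insert j T\<close> and no reindexing occurs.\<close>

definition mvec :: "'a set \<Rightarrow> ('a \<Rightarrow> 'a \<Rightarrow> real) \<Rightarrow> ('a \<Rightarrow> real) \<Rightarrow> 'a \<Rightarrow> real" where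
  "mvec T B x i = (\<Sum>k\<in>T. B i k * x k)"

definition qform :: "'a set \<Rightarrow> ('a \<Rightarrow> 'a \<Rightarrow> real) \<Rightarrow> ('a \<Rightarrow> real) \<Rightarrow> real" where
  "qform T B x = (\<Sum>i\<in>T. x i * mvec T B x i)"

definition psd_on :: "'a set \<Rightarrow> ('a \<Rightarrow> 'a \<Rightarrow> real) \<Rightarrow> bool" where
  "psd_on T Q \<longleftrightarrow> (\<forall>x. 0 \<le> qform T Q x)"

definition trace_on :: "'a set \<Rightarrow> ('a \<Rightarrow> 'a \<Rightarrow> real) \<Rightarrow> real" where
  "trace_on T B = (\<Sum>i\<in>T. B i i)"

definition frob_on :: "'a set \<Rightarrow> ('a \<Rightarrow> 'a \<Rightarrow> real) \<Rightarrow> real" where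
  "frob_on T B = (\<Sum>i\<in>T. \<Sum>k\<in>T. (B i k)\<^sup>2)"

text \<open>Positivity of the inverse \<open>B\<close> is encoded as \<open>tr (B Q) \<ge> 0\<close> for all positive semidefinite \<open>Q\<close>; this form
  is inherited by bordered inverses and needs no spectral decomposition.\<close>

definition pos_inverse :: "'a set \<Rightarrow> ('a \<Rightarrow> 'a \<Rightarrow> real) \<Rightarrow> ('a \<Rightarrow> 'a \<Rightarrow> real) \<Rightarrow> bool" where
  "pos_inverse T M B \<longleftrightarrow>
     (\<forall>i\<in>T. \<forall>k\<in>T. B i k = B k i) \<and>
     (\<forall>i\<in>T. \<forall>k\<in>T. (\<Sum>l\<in>T. M i l * B l k) = of_bool (i = k)) \<and>
     (\<forall>Q. psd_on T Q \<longrightarrow> 0 \<le> (\<Sum>i\<in>T. \<Sum>k\<in>T. B i k * Q i k))"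

section \<open>Elementary rules for quadratic forms and positive inverses\<close>

lemma qform_alt: "qform T B x = (\<Sum>i\<in>T. \<Sum>k\<in>T. x i * B i k * x k)"
  unfolding qform_def mvec_def by (simp only: sum_distrib_left mult.assoc)

lemma sum_mult_sum_swap:
  fixes a b :: "'a \<Rightarrow> real"
  shows "(\<Sum>l\<in>T. a l * (\<Sum>m\<in>T. c l m * b m)) = (\<Sum>m\<in>T. (\<Sum>l\<in>T. a l * c l m) * b m)"
  unfolding sum_distrib_left sum_distrib_right mult.assoc by (rule sum.swap)

lemma mvec_right_inverse:
  assumes "finite T" "pos_inverse T M B" "i \<in> T"
  shows "mvec T M (mvec T B x) i = x i"
proof -
  have "mvec T M (mvec T B x) i = (\<Sum>k\<in>T. (\<Sum>l\<in>T. M i l * B l k) * x k)"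
    unfolding mvec_def by (rule sum_mult_sum_swap)
  also have "\<dots> = (\<Sum>k\<in>T. if i = k then x k else 0)"
    using assms by (intro sum.cong) (auto simp: pos_inverse_def)
  finally show ?thesis using assms by simp
qed

text \<open>Transposing \<open>M B = 1\<close> gives \<open>B M = 1\<close>, since both matrices are
  symmetric.\<close>

lemma pos_inverse_left:
  assumes "pos_inverse T M B" "\<And>i k. M i k = M k i" "i \<in> T" "k \<in> T"
  shows "(\<Sum>l\<in>T. B i l * M l k) = of_bool (i = k)"
proof -
  have "(\<Sum>l\<in>T. B i l * M l k) = (\<Sum>l\<in>T. M k l * B l i)"
    using assms by (intro sum.cong) (auto simp: pos_inverse_def)
  also have "\<dots> = of_bool (k = i)" using assms(1,3,4) by (simp add: pos_inverse_def)
  finally show ?thesis by (cases "i = k") auto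
qed

lemma mvec_left_inverse:
  assumes "finite T" "pos_inverse T M B" "\<And>i k. M i k = M k i" "i \<in> T"
  shows "mvec T B (mvec T M x) i = x i"
proof -
  have "mvec T B (mvec T M x) i = (\<Sum>k\<in>T. (\<Sum>l\<in>T. B i l * M l k) * x k)"
    unfolding mvec_def by (rule sum_mult_sum_swap)
  also have "\<dots> = (\<Sum>k\<in>T. if i = k then x k else 0)"
    using assms pos_inverse_left[OF assms(2,3)] by (intro sum.cong) auto
  finally show ?thesis using assms by simp
qed

lemma psd_on_rank_one: "psd_on T (\<lambda>i k. y i * y k)"
proof -
  have "qform T (\<lambda>i k. y i * y k) x = (\<Sum>i\<in>T. x i * y i)\<^sup>2" for x
    unfolding qform_alt power2_eq_square sum_product by (simp add: mult_ac)
  then show ?thesis by (simp add: psd_on_def)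
qed

text \<open>The trace pairing of \<open>B\<close> with the rank-one matrix \<open>x x^T\<close> is
  the quadratic form of \<open>B\<close> at \<open>x\<close>.\<close>

lemma pos_inverse_qform_nonneg:
  assumes "pos_inverse T M B"
  shows "0 \<le> qform T B x"
proof -
  have "0 \<le> (\<Sum>i\<in>T. \<Sum>k\<in>T. B i k * (x i * x k))"
    using assms psd_on_rank_one[of T x] by (simp add: pos_inverse_def)
  then show ?thesis by (simp add: qform_alt mult_ac)
qed

text \<open>Substituting \<open>y = M x\<close> gives \<open>y^T B y = x^T M x\<close>, which
  transfers nonnegativity from \<open>B\<close> to \<open>M\<close>.\<close>

lemma pos_inverse_imp_psd:
  assumes "finite T" "pos_inverse T M B" "\<And>i k. M i k = M k i"
  shows "psd_on T M"
  unfolding psd_on_def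
proof
  fix x
  have "qform T B (mvec T M x) = qform T M x"
    using mvec_left_inverse[OF assms] unfolding qform_def by (simp add: mult.commute)
  then show "0 \<le> qform T M x"
    using pos_inverse_qform_nonneg[OF assms(2), of "mvec T M x"] by simp
qed

lemma qform_extend_zero:
  assumes "finite T" "j \<notin> T"
  shows "qform (insert j T) Q (\<lambda>i. if i = j then 0 else x i) = qform T Q x"
proof -
  have "(\<Sum>i\<in>T. \<Sum>k\<in>T. (if i = j then 0 else x i) * Q i k * (if k = j then 0 else x k))
      = (\<Sum>i\<in>T. \<Sum>k\<in>T. x i * Q i k * x k)"
    using assms by (intro sum.cong) auto
  then show ?thesis using assms by (simp add: qform_alt)
qed

lemma psd_on_subset_insert:
  assumes "finite T" "j \<notin> T" "psd_on (insert j T) Q"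
  shows "psd_on T Q"
  using assms qform_extend_zero[OF assms(1,2)] unfolding psd_on_def by metis

text \<open>This is the block vector \<open>(- B v, 1)\<close> of Gaussian elimination, where
  \<open>v\<close> is column \<open>j\<close> of \<open>M\<close> on \<open>T\<close>; its form
  under \<open>M\<close> is the Schur complement of \<open>T\<close>.\<close>

definition border_vec :: "'a set \<Rightarrow> ('a \<Rightarrow> 'a \<Rightarrow> real) \<Rightarrow> ('a \<Rightarrow> 'a \<Rightarrow> real) \<Rightarrow> 'a \<Rightarrow> 'a \<Rightarrow> real" where
  "border_vec T M B j i = (if i = j then 1 else - mvec T B (\<lambda>k. M k j) i)"

text \<open>The rows in \<open>T\<close> cancel because \<open>M B v = v\<close>; row
  \<open>j\<close>, equal to \<open>v\<close> by symmetry, leaves the Schur complement.\<close>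

lemma mvec_border_vec:
  assumes "finite T" "j \<notin> T" "pos_inverse T M B" "\<And>i k. M i k = M k i" "i \<in> insert j T"
  shows "mvec (insert j T) M (border_vec T M B j) i
    = (if i = j then M j j - qform T B (\<lambda>k. M k j) else 0)"
proof -
  let ?v = "\<lambda>k. M k j"
  have "(\<Sum>l\<in>T. M i l * border_vec T M B j l) = (\<Sum>l\<in>T. - (M i l * mvec T B ?v l))"
    using assms(2) by (intro sum.cong) (auto simp: border_vec_def)
  then have eq: "mvec (insert j T) M (border_vec T M B j) i = M i j - (\<Sum>l\<in>T. M i l * mvec T B ?v l)"
    using assms(1,2) by (simp add: mvec_def[of "insert j T"] sum_negf) (simp add: border_vec_def)
  show ?thesis
  proof (cases "i = j")
    case True
    then show ?thesis using eq assms(4) by (simp add: qform_def)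
  next
    case False
    then have "i \<in> T" using assms(5) by simp
    then have "(\<Sum>l\<in>T. M i l * mvec T B ?v l) = M i j"
      using mvec_right_inverse[OF assms(1,3), of i ?v] by (simp add: mvec_def[of T M])
    then show ?thesis using eq False by simp
  qed
qed

text \<open>Block inversion: the new inverse is \<open>B\<close> padded by zeros plus
  \<open>u u^T\<close> over the Schur complement. Both summands pair nonnegatively with a psd
  \<open>Q\<close>, the first after restricting \<open>Q\<close> to \<open>T\<close>, the second as
  a value of the form of \<open>Q\<close>. The trace grows by the squared norm of \<open>u\<close>
  over the Schur complement.\<close>

lemma pos_inverse_insert:
  assumes fin: "finite T" and j: "j \<notin> T" and inv: "pos_inverse T M B"
    and sym: "\<And>i k. M i k = M k i" and pos: "0 < M j j - qform T B (\<lambda>k. M k j)"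
  obtains B' where "pos_inverse (insert j T) M B'"
    "trace_on (insert j T) B' = trace_on T B +
       (1 + (\<Sum>i\<in>T. (mvec T B (\<lambda>k. M k j) i)\<^sup>2)) / (M j j - qform T B (\<lambda>k. M k j))"
proof -
  define \<kappa> where "\<kappa> = M j j - qform T B (\<lambda>k. M k j)"
  define u where "u = border_vec T M B j"
  \<comment> \<open>\<open>M u\<close> is \<open>\<kappa>\<close> times the unit vector at \<open>j\<close>, so the bordered inverse is a rank-one update.\<close>
  define B' where "B' i k = (if i \<in> T \<and> k \<in> T then B i k else 0) + u i * u k / \<kappa>" for i k
  have kpos: "\<kappa> > 0" using pos by (simp add: \<kappa>_def)
  have Mu: "(\<Sum>l\<in>insert j T. M i l * u l) = (if i = j then \<kappa> else 0)" if "i \<in> insert j T" for i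
    using mvec_border_vec[OF fin j inv sym that] by (simp add: mvec_def[of "insert j T"] u_def \<kappa>_def)
  have uj: "u j = 1" by (simp add: u_def border_vec_def)
  \<comment> \<open>In row \<open>j\<close> of \<open>M B'\<close> and a column in \<open>T\<close>,
    the padded block contributes minus the entry of \<open>u\<close>, which cancels the rank-one
    term.\<close>
  have uT: "u i = - (\<Sum>l\<in>T. M j l * B l i)" if "i \<in> T" for i
  proof -
    have "(\<Sum>l\<in>T. M j l * B l i) = (\<Sum>l\<in>T. B i l * M l j)"
      using that inv sym by (intro sum.cong) (auto simp: pos_inverse_def)
    then show ?thesis using that j by (auto simp: u_def border_vec_def mvec_def)
  qed
  have prod: "(\<Sum>l\<in>insert j T. M i l * B' l k) = of_bool (i = k)"
    if i: "i \<in> insert j T" and k: "k \<in> insert j T" for i k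
  proof -
    have "(\<Sum>l\<in>insert j T. M i l * B' l k)
      = (\<Sum>l\<in>insert j T. M i l * (if l \<in> T \<and> k \<in> T then B l k else 0))
        + (\<Sum>l\<in>insert j T. M i l * u l) * (u k / \<kappa>)"
      unfolding sum_distrib_right sum.distrib[symmetric]
      by (intro sum.cong) (auto simp: B'_def algebra_simps)
    also have "(\<Sum>l\<in>insert j T. M i l * (if l \<in> T \<and> k \<in> T then B l k else 0))
      = (if k \<in> T then \<Sum>l\<in>T. M i l * B l k else 0)"
      using fin j by simp
    finally have eq: "(\<Sum>l\<in>insert j T. M i l * B' l k) = (if k \<in> T then \<Sum>l\<in>T. M i l * B l k else 0)
        + (if i = j then \<kappa> else 0) * (u k / \<kappa>)"
      using Mu[OF i] by simp
    show ?thesis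
    proof (cases "i = j")
      case True
      then show ?thesis using eq kpos uj uT k j by auto
    next
      case False
      then have "i \<in> T" using i by simp
      then show ?thesis using eq False inv k j by (auto simp: pos_inverse_def)
    qed
  qed
  have tp: "0 \<le> (\<Sum>i\<in>insert j T. \<Sum>k\<in>insert j T. B' i k * Q i k)" if Q: "psd_on (insert j T) Q" for Q
  proof -
    have "(\<Sum>i\<in>insert j T. \<Sum>k\<in>insert j T. B' i k * Q i k) =
      (\<Sum>i\<in>insert j T. \<Sum>k\<in>insert j T. (if i \<in> T \<and> k \<in> T then B i k else 0) * Q i k)
      + (\<Sum>i\<in>insert j T. \<Sum>k\<in>insert j T. u i * Q i k * u k / \<kappa>)"
      unfolding sum.distrib[symmetric] by (intro sum.cong) (auto simp: B'_def algebra_simps)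
    also have "(\<Sum>i\<in>insert j T. \<Sum>k\<in>insert j T. (if i \<in> T \<and> k \<in> T then B i k else 0) * Q i k)
      = (\<Sum>i\<in>T. \<Sum>k\<in>T. B i k * Q i k)" using fin j by simp
    also have "(\<Sum>i\<in>insert j T. \<Sum>k\<in>insert j T. u i * Q i k * u k / \<kappa>) = qform (insert j T) Q u / \<kappa>"
      by (simp add: qform_alt sum_divide_distrib)
    finally show ?thesis
      using psd_on_subset_insert[OF fin j Q] Q inv kpos by (simp add: pos_inverse_def psd_on_def)
  qed
  have "pos_inverse (insert j T) M B'"
    unfolding pos_inverse_def
  proof (intro conjI ballI allI impI)
    show "B' i k = B' k i" if "i \<in> insert j T" "k \<in> insert j T" for i k
      using inv unfolding B'_def pos_inverse_def by (auto simp: mult.commute)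
  qed (use prod tp in auto)
  moreover have "trace_on (insert j T) B' = trace_on T B + (1 + (\<Sum>i\<in>T. (mvec T B (\<lambda>k. M k j) i)\<^sup>2)) / \<kappa>"
  proof -
    have "(\<Sum>i\<in>T. u i * u i) = (\<Sum>i\<in>T. (mvec T B (\<lambda>k. M k j) i)\<^sup>2)"
      using j by (intro sum.cong) (auto simp: u_def border_vec_def power2_eq_square)
    then show ?thesis
      using fin j uj by (simp add: trace_on_def B'_def sum.distrib sum_divide_distrib[symmetric] add_divide_distrib)
  qed
  ultimately show ?thesis using that unfolding \<kappa>_def by blast
qed

text \<open>Induction on \<open>T\<close>: evaluating the lower bound at \<open>border_vec\<close>,
  whose entry at \<open>j\<close> is 1, shows that the Schur complement is at least
  \<open>c\<close>, so bordering applies. The bound passes to smaller index sets by extending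
  vectors with zero.\<close>

lemma pos_inverse_exists:
  assumes "finite T" and sym: "\<And>i k. M i k = M k i" and "c > 0"
    and "\<And>x. c * (\<Sum>i\<in>T. (x i)\<^sup>2) \<le> qform T M x"
  shows "\<exists>B. pos_inverse T M B"
  using assms(1,4)
proof (induction T rule: finite_induct)
  case empty
  then show ?case by (simp add: pos_inverse_def)
next
  case (insert j T)
  have "c * (\<Sum>i\<in>T. (x i)\<^sup>2) \<le> qform T M x" for x
  proof -
    have "(\<Sum>i\<in>T. (if i = j then 0 else x i)\<^sup>2) = (\<Sum>i\<in>T. (x i)\<^sup>2)"
      using insert.hyps by (intro sum.cong) auto
    then show ?thesis
      using insert.prems[of "\<lambda>i. if i = j then 0 else x i"] insert.hyps
      by (simp add: qform_extend_zero)
  qed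
  then obtain B where B: "pos_inverse T M B" using insert.IH by blast
  let ?u = "border_vec T M B j"
  have uj: "?u j = 1" by (simp add: border_vec_def)
  have "c * (\<Sum>i\<in>insert j T. (?u i)\<^sup>2) \<le> qform (insert j T) M ?u"
    by (rule insert.prems)
  also have "\<dots> = (\<Sum>i\<in>insert j T. ?u i * (if i = j then M j j - qform T B (\<lambda>k. M k j) else 0))"
    unfolding qform_def[of "insert j T"]
    by (intro sum.cong) (use mvec_border_vec[OF insert.hyps B sym] in auto)
  also have "\<dots> = M j j - qform T B (\<lambda>k. M k j)"
    using insert.hyps uj by (simp, intro sum.neutral) auto
  finally have "c * (\<Sum>i\<in>insert j T. (?u i)\<^sup>2) \<le> M j j - qform T B (\<lambda>k. M k j)" .
  moreover have "c * 1 \<le> c * (\<Sum>i\<in>insert j T. (?u i)\<^sup>2)"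
    using insert.hyps uj \<open>c > 0\<close> by (intro mult_left_mono) (auto simp: sum_nonneg)
  ultimately have "0 < M j j - qform T B (\<lambda>k. M k j)" using \<open>c > 0\<close> by linarith
  then show ?case using pos_inverse_insert[OF insert.hyps B sym] by metis
qed

section \<open>Effect of a diagonal shift on the inverse\<close>

lemma resolvent_identity:
  assumes fin: "finite T" and B: "pos_inverse T M B" and B': "pos_inverse T M' B'"
    and sym: "\<And>i k. M i k = M k i"
    and M': "\<And>i k. M' i k = M i k + d * of_bool (i = k)" and ik: "i \<in> T" "k \<in> T"
  shows "B i k - B' i k = d * (\<Sum>l\<in>T. B i l * B' l k)"
proof -
  \<comment> \<open>Expand \<open>B\<close> as \<open>B M' B'\<close> and split
    \<open>M' = M + d\<close>; then \<open>B M B'\<close> collapses to \<open>B'\<close>.\<close>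
  have "B i k = (\<Sum>l\<in>T. B i l * (\<Sum>m\<in>T. M' l m * B' m k))"
  proof -
    have "(\<Sum>l\<in>T. B i l * (\<Sum>m\<in>T. M' l m * B' m k)) = (\<Sum>l\<in>T. if l = k then B i l else 0)"
      using B' ik by (intro sum.cong) (auto simp: pos_inverse_def)
    then show ?thesis using fin ik by simp
  qed
  also have "\<dots> = (\<Sum>l\<in>T. B i l * ((\<Sum>m\<in>T. M l m * B' m k) + d * B' l k))"
  proof (intro sum.cong refl)
    fix l assume "l \<in> T"
    have "(\<Sum>m\<in>T. M' l m * B' m k) = (\<Sum>m\<in>T. M l m * B' m k) + (\<Sum>m\<in>T. if l = m then d * B' m k else 0)"
      unfolding sum.distrib[symmetric] M' by (intro sum.cong) (auto simp: algebra_simps)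
    then show "B i l * (\<Sum>m\<in>T. M' l m * B' m k) = B i l * ((\<Sum>m\<in>T. M l m * B' m k) + d * B' l k)"
      using \<open>l \<in> T\<close> fin by simp
  qed
  also have "\<dots> = (\<Sum>l\<in>T. B i l * (\<Sum>m\<in>T. M l m * B' m k)) + d * (\<Sum>l\<in>T. B i l * B' l k)"
    by (simp add: algebra_simps sum.distrib sum_distrib_left)
  also have "(\<Sum>l\<in>T. B i l * (\<Sum>m\<in>T. M l m * B' m k)) = B' i k"
    using mvec_left_inverse[OF fin B sym ik(1), of "\<lambda>m. B' m k"] by (simp add: mvec_def)
  finally show ?thesis by simp
qed

text \<open>By the resolvent identity the trace drops by \<open>d * tr (B B')\<close>. Replacing
  \<open>B\<close> by \<open>B'\<close> there loses
  \<open>tr ((B - B') B') = d * tr (B' B B')\<close>, a nonnegative sum of values of the form of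
  \<open>B\<close> at the columns of \<open>B'\<close>. This drop later pays for the second powers
  of the inverses.\<close>

lemma trace_resolvent_decrease:
  assumes fin: "finite T" and B: "pos_inverse T M B" and B': "pos_inverse T M' B'"
    and sym: "\<And>i k. M i k = M k i"
    and M': "\<And>i k. M' i k = M i k + d * of_bool (i = k)" and "d \<ge> 0"
  shows "d * frob_on T B' \<le> trace_on T B - trace_on T B'"
proof -
  note res = resolvent_identity[OF fin B B' sym M']
  have symB': "B' i k = B' k i" if "i \<in> T" "k \<in> T" for i k
    using B' that by (simp add: pos_inverse_def)
  have tr: "trace_on T B - trace_on T B' = d * (\<Sum>i\<in>T. \<Sum>l\<in>T. B i l * B' i l)"
    unfolding trace_on_def sum_subtractf[symmetric] sum_distrib_left
  proof (intro sum.cong refl)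
    fix i assume i: "i \<in> T"
    have "B i i - B' i i = (\<Sum>l\<in>T. d * (B i l * B' l i))"
      using res[OF i i] by (simp add: sum_distrib_left)
    also have "\<dots> = (\<Sum>l\<in>T. d * (B i l * B' i l))" using i symB' by (intro sum.cong) auto
    finally show "B i i - B' i i = (\<Sum>l\<in>T. d * (B i l * B' i l))" .
  qed
  have "(\<Sum>i\<in>T. \<Sum>l\<in>T. B i l * B' i l) - frob_on T B' = (\<Sum>i\<in>T. \<Sum>l\<in>T. (B i l - B' i l) * B' i l)"
    by (simp add: frob_on_def sum_subtractf[symmetric] algebra_simps power2_eq_square)
  also have "\<dots> = (\<Sum>i\<in>T. \<Sum>l\<in>T. d * (B' i l * (\<Sum>m\<in>T. B i m * B' m l)))"
    using res by (intro sum.cong) auto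
  also have "\<dots> = (\<Sum>l\<in>T. d * qform T B (\<lambda>i. B' i l))"
    unfolding qform_def mvec_def sum_distrib_left[of d]
    by (rule sum.swap)
  also have "\<dots> \<ge> 0"
    using pos_inverse_qform_nonneg[OF B] \<open>d \<ge> 0\<close> by (intro sum_nonneg) auto
  finally have "frob_on T B' \<le> (\<Sum>i\<in>T. \<Sum>l\<in>T. B i l * B' i l)" by simp
  then show ?thesis unfolding tr using \<open>d \<ge> 0\<close> by (rule mult_left_mono)
qed

subsection \<open>The barrier argument\<close>

text \<open>By \<open>K\<close>, the matrix \<open>Q\<close>, \<open>K\<close> times the identity
  minus the sum of the \<open>g g^T\<close> over the columns \<open>g\<close> of \<open>G\<close>,
  is psd on \<open>T\<close>; pairing it with \<open>B\<close> gives the claim.\<close>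

lemma sum_qform_le:
  assumes fin: "finite T" "finite P" and B: "pos_inverse T M B" and sym: "\<And>i k. G i k = G k i"
    and K: "\<And>x. (\<Sum>j\<in>P. (mvec T G x j)\<^sup>2) \<le> K * (\<Sum>i\<in>T. (x i)\<^sup>2)"
  shows "(\<Sum>j\<in>P. qform T B (\<lambda>k. G k j)) \<le> K * trace_on T B"
proof -
  define Q where "Q i k = K * of_bool (i = k) - (\<Sum>j\<in>P. G i j * G k j)" for i k
  have "qform T Q x = K * (\<Sum>i\<in>T. (x i)\<^sup>2) - (\<Sum>j\<in>P. (mvec T G x j)\<^sup>2)" for x
  proof -
    have "qform T Q x = (\<Sum>i\<in>T. \<Sum>k\<in>T. if i = k then K * x i * x k else 0)
        - (\<Sum>i\<in>T. \<Sum>k\<in>T. \<Sum>j\<in>P. x i * (G i j * G k j) * x k)"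
      unfolding qform_alt sum_subtractf[symmetric]
      by (intro sum.cong) (auto simp: Q_def algebra_simps sum_distrib_left)
    also have "(\<Sum>i\<in>T. \<Sum>k\<in>T. if i = k then K * x i * x k else 0) = K * (\<Sum>i\<in>T. (x i)\<^sup>2)"
      using fin by (simp add: sum_distrib_left power2_eq_square mult.assoc)
    also have "(\<Sum>i\<in>T. \<Sum>k\<in>T. \<Sum>j\<in>P. x i * (G i j * G k j) * x k)
        = (\<Sum>i\<in>T. \<Sum>j\<in>P. \<Sum>k\<in>T. (G j i * x i) * (G j k * x k))"
      by (rule sum.cong[OF refl], rule trans[OF sum.swap], intro sum.cong refl) (metis sym mult.assoc mult.commute)
    also have "\<dots> = (\<Sum>j\<in>P. \<Sum>i\<in>T. \<Sum>k\<in>T. (G j i * x i) * (G j k * x k))"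
      by (rule sum.swap)
    also have "\<dots> = (\<Sum>j\<in>P. (mvec T G x j)\<^sup>2)"
      by (simp add: mvec_def power2_eq_square sum_product)
    finally show ?thesis .
  qed
  then have "psd_on T Q" using K by (simp add: psd_on_def)
  then have "0 \<le> (\<Sum>i\<in>T. \<Sum>k\<in>T. B i k * Q i k)" using B by (simp add: pos_inverse_def)
  also have "\<dots> = (\<Sum>i\<in>T. \<Sum>k\<in>T. if i = k then K * B i k else 0)
      - (\<Sum>i\<in>T. \<Sum>k\<in>T. \<Sum>j\<in>P. G i j * B i k * G k j)"
    unfolding sum_subtractf[symmetric]
    by (intro sum.cong) (auto simp: Q_def algebra_simps sum_distrib_left)
  also have "(\<Sum>i\<in>T. \<Sum>k\<in>T. if i = k then K * B i k else 0) = K * trace_on T B"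
    using fin by (simp add: trace_on_def sum_distrib_left)
  also have "(\<Sum>i\<in>T. \<Sum>k\<in>T. \<Sum>j\<in>P. G i j * B i k * G k j)
      = (\<Sum>i\<in>T. \<Sum>j\<in>P. \<Sum>k\<in>T. G i j * B i k * G k j)"
    by (rule sum.cong[OF refl], rule sum.swap)
  also have "\<dots> = (\<Sum>j\<in>P. qform T B (\<lambda>k. G k j))"
    unfolding qform_alt by (rule sum.swap)
  finally show ?thesis by simp
qed

text \<open>Entry \<open>i\<close> of \<open>B\<close> applied to column \<open>j\<close> of
  \<open>G\<close> is entry \<open>j\<close> of \<open>G\<close> applied to row \<open>i\<close> of
  \<open>B\<close>, so \<open>K\<close> is used once for each row of \<open>B\<close>.\<close>

lemma sum_mvec_squares_le:
  assumes sym: "\<And>i k. G i k = G k i"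
    and K: "\<And>x. (\<Sum>j\<in>P. (mvec T G x j)\<^sup>2) \<le> K * (\<Sum>i\<in>T. (x i)\<^sup>2)"
  shows "(\<Sum>j\<in>P. \<Sum>i\<in>T. (mvec T B (\<lambda>k. G k j) i)\<^sup>2) \<le> K * frob_on T B"
proof -
  have "mvec T B (\<lambda>k. G k j) i = mvec T G (B i) j" for i j
    unfolding mvec_def by (intro sum.cong refl) (metis sym mult.commute)
  then have "(\<Sum>j\<in>P. \<Sum>i\<in>T. (mvec T B (\<lambda>k. G k j) i)\<^sup>2) = (\<Sum>i\<in>T. \<Sum>j\<in>P. (mvec T G (B i) j)\<^sup>2)"
    by (simp add: sum.swap[of _ P T])
  also have "\<dots> \<le> (\<Sum>i\<in>T. K * (\<Sum>k\<in>T. (B i k)\<^sup>2))"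
    by (intro sum_mono K)
  finally show ?thesis by (simp add: frob_on_def sum_distrib_left)
qed

section \<open>Gap matrices and the potential\<close>

definition off_gram :: "('a \<Rightarrow> 'a \<Rightarrow> real) \<Rightarrow> 'a \<Rightarrow> 'a \<Rightarrow> real" where
  "off_gram G i k = G i k - of_bool (i = k)"

text \<open>For symmetric \<open>G\<close>, positive semidefiniteness of this matrix and of
  \<open>lower_gap\<close> on \<open>T\<close> says that the eigenvalues of \<open>G\<close> on
  \<open>T\<close> lie between \<open>1 - b\<close> and \<open>1 + b\<close>.\<close>

definition upper_gap :: "('a \<Rightarrow> 'a \<Rightarrow> real) \<Rightarrow> real \<Rightarrow> 'a \<Rightarrow> 'a \<Rightarrow> real" where
  "upper_gap G b i k = b * of_bool (i = k) - off_gram G i k"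

definition lower_gap :: "('a \<Rightarrow> 'a \<Rightarrow> real) \<Rightarrow> real \<Rightarrow> 'a \<Rightarrow> 'a \<Rightarrow> real" where
  "lower_gap G b i k = b * of_bool (i = k) + off_gram G i k"

text \<open>The existence of positive inverses certifies that both gap matrices are positive
  definite on \<open>T\<close>; \<open>S\<close> bounds the potential.\<close>

definition barrier :: "('a \<Rightarrow> 'a \<Rightarrow> real) \<Rightarrow> 'a set \<Rightarrow> real \<Rightarrow> real \<Rightarrow> bool" where
  "barrier G T b S \<longleftrightarrow> (\<exists>B C. pos_inverse T (upper_gap G b) B \<and> pos_inverse T (lower_gap G b) C
     \<and> trace_on T B + trace_on T C \<le> S)"

text \<open>For \<open>G = X^T X\<close> this reads \<open>|X^T (X x)|^2 \<le> N |X x|^2\<close> for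
  \<open>x\<close> supported on \<open>T\<close>. Keeping the form of \<open>G\<close> on the right
  lets the upper barrier replace it by \<open>1 + b\<close> times the squared norm of
  \<open>x\<close>.\<close>

definition frame_bound :: "'a set \<Rightarrow> ('a \<Rightarrow> 'a \<Rightarrow> real) \<Rightarrow> real \<Rightarrow> bool" where
  "frame_bound P G N \<longleftrightarrow>
     (\<forall>T x. T \<subseteq> P \<longrightarrow> (\<Sum>j\<in>P. (mvec T G x j)\<^sup>2) \<le> N * qform T G x)"

lemma qform_add_scalar:
  assumes "finite T" "\<And>i k. M' i k = M i k + d * of_bool (i = k)"
  shows "qform T M' x = qform T M x + d * (\<Sum>i\<in>T. (x i)\<^sup>2)"
proof -
  have "qform T M' x = (\<Sum>i\<in>T. \<Sum>k\<in>T. x i * M i k * x k) + (\<Sum>i\<in>T. \<Sum>k\<in>T. if i = k then d * (x i * x k) else 0)"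
    unfolding qform_alt sum.distrib[symmetric] by (intro sum.cong) (auto simp: assms algebra_simps)
  then show ?thesis using assms by (simp add: qform_alt sum_distrib_left power2_eq_square)
qed

lemma qform_uminus: "qform T (\<lambda>i k. - M i k) x = - qform T M x"
  by (simp add: qform_alt sum_negf)

lemma qform_upper_gap:
  assumes "finite T"
  shows "qform T (upper_gap G b) x = (1 + b) * (\<Sum>i\<in>T. (x i)\<^sup>2) - qform T G x"
proof -
  have "qform T (upper_gap G b) x = qform T (\<lambda>i k. - G i k) x + (1 + b) * (\<Sum>i\<in>T. (x i)\<^sup>2)"
    by (rule qform_add_scalar) (auto simp: assms upper_gap_def off_gram_def algebra_simps)
  then show ?thesis by (simp add: qform_uminus)
qed

lemma qform_lower_gap:
  assumes "finite T"
  shows "qform T (lower_gap G b) x = qform T G x - (1 - b) * (\<Sum>i\<in>T. (x i)\<^sup>2)"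
proof -
  have "qform T (lower_gap G b) x = qform T G x + (b - 1) * (\<Sum>i\<in>T. (x i)\<^sup>2)"
    by (rule qform_add_scalar) (auto simp: assms lower_gap_def off_gram_def algebra_simps)
  then show ?thesis by (simp add: algebra_simps)
qed

text \<open>A psd matrix plus \<open>d\<close> times the identity has a form bounded below by
  \<open>d\<close> times the squared norm, hence a positive inverse.\<close>

lemma pos_inverse_shift:
  assumes fin: "finite T" and B: "pos_inverse T M B"
    and sym: "\<And>i k. M i k = M k i"
    and M': "\<And>i k. M' i k = M i k + d * of_bool (i = k)" and "d > 0"
  obtains B' where "pos_inverse T M' B'" "d * frob_on T B' \<le> trace_on T B - trace_on T B'"
proof -
  have "\<exists>B'. pos_inverse T M' B'"
  proof (rule pos_inverse_exists[OF fin _ \<open>d > 0\<close>])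
    show "M' i k = M' k i" for i k unfolding M' using sym[of i k] by (cases "i = k") auto
    show "d * (\<Sum>i\<in>T. (x i)\<^sup>2) \<le> qform T M' x" for x
      using pos_inverse_imp_psd[OF fin B sym] qform_add_scalar[OF fin M', of x]
      by (simp add: psd_on_def)
  qed
  then show ?thesis
    using trace_resolvent_decrease[OF fin B _ sym M'] \<open>d > 0\<close> that by fastforce
qed

text \<open>Since \<open>(b - a) * (b - c)\<close> exceeds \<open>b * (b - (a + c))\<close> by
  \<open>a * c\<close>, the worst case puts the whole loss on one side. The two increments are
  thereby controlled through the sums \<open>a + c\<close> and \<open>\<alpha> + \<gamma>\<close>,
  which can be averaged jointly.\<close>

lemma two_sided_increment_le:
  fixes b a c :: real
  assumes "0 \<le> a" "0 \<le> c" "a + c < b" "0 \<le> \<alpha>" "0 \<le> \<gamma>"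
  shows "(1 + \<alpha>) / (b - a) + (1 + \<gamma>) / (b - c) \<le> 1 / b + (1 + (\<alpha> + \<gamma>)) / (b - (a + c))"
proof -
  have "1 / (b - a) + 1 / (b - c) \<le> 1 / b + 1 / (b - (a + c))"
  proof -
    have "1 / (b - a) + 1 / (b - c) = (2 * b - (a + c)) / ((b - a) * (b - c))"
      using assms by (simp add: field_simps)
    also have "\<dots> \<le> (2 * b - (a + c)) / (b * (b - (a + c)))"
      using assms by (intro divide_left_mono mult_pos_pos) (auto simp: algebra_simps)
    also have "\<dots> = 1 / b + 1 / (b - (a + c))"
      using assms by (simp add: field_simps)
    finally show ?thesis .
  qed
  moreover have "\<alpha> / (b - a) \<le> \<alpha> / (b - (a + c))" "\<gamma> / (b - c) \<le> \<gamma> / (b - (a + c))"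
    using assms by (auto intro!: divide_left_mono)
  ultimately show ?thesis by (simp add: add_divide_distrib)
qed

text \<open>This prevents selecting a column twice, since a selected column has a form value below a
  level less than 1. For \<open>j\<close> in \<open>T\<close>, column \<open>j\<close> of
  \<open>G\<close> is that of the gap matrix plus \<open>1 - b\<close> times the unit vector, and
  the form equals \<open>1 + (1 - b) * (1 + (1 - b) * C j j)\<close>.\<close>

lemma qform_lower_inverse_ge_one:
  assumes fin: "finite T" and C: "pos_inverse T (lower_gap G b) C" and sym: "\<And>i k. G i k = G k i"
    and j: "j \<in> T" "G j j = 1" and b: "b \<le> 1"
  shows "1 \<le> qform T C (\<lambda>k. G k j)"
proof -
  have symL: "lower_gap G b i k = lower_gap G b k i" for i k
    using sym by (auto simp: lower_gap_def off_gram_def)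
  have G: "G k j = lower_gap G b k j + (1 - b) * of_bool (k = j)" for k
    by (simp add: lower_gap_def off_gram_def algebra_simps)
  have Cv: "mvec T C (\<lambda>k. G k j) i = of_bool (i = j) + (1 - b) * C i j" if i: "i \<in> T" for i
  proof -
    have "mvec T C (\<lambda>k. G k j) i
        = (\<Sum>k\<in>T. C i k * lower_gap G b k j) + (\<Sum>k\<in>T. if k = j then (1 - b) * C i k else 0)"
      unfolding mvec_def sum.distrib[symmetric]
      by (intro sum.cong) (auto simp: G algebra_simps)
    then show ?thesis using pos_inverse_left[OF C symL i j(1)] fin j by simp
  qed
  have "qform T C (\<lambda>k. G k j) = (\<Sum>i\<in>T. G i j * (of_bool (i = j) + (1 - b) * C i j))"
    unfolding qform_def using Cv by simp
  also have "\<dots> = (\<Sum>i\<in>T. if i = j then G i j else 0) + (1 - b) * (\<Sum>i\<in>T. C j i * G i j)"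
    unfolding sum_distrib_left sum.distrib[symmetric]
    using C j by (intro sum.cong) (auto simp: algebra_simps pos_inverse_def)
  also have "\<dots> = 1 + (1 - b) * (1 + (1 - b) * C j j)"
    using Cv[OF j(1)] fin j by (simp add: mvec_def)
  also have "\<dots> \<ge> 1"
  proof -
    have "qform T C (\<lambda>k. of_bool (k = j)) = (\<Sum>i\<in>T. if i = j then mvec T C (\<lambda>k. of_bool (k = j)) i else 0)"
      unfolding qform_def by (intro sum.cong) auto
    also have "\<dots> = (\<Sum>k\<in>T. if k = j then C j k else 0)"
      using fin j by (simp add: mvec_def)
    finally have "C j j \<ge> 0" using pos_inverse_qform_nonneg[OF C, of "\<lambda>k. of_bool (k = j)"] fin j by simp
    then show ?thesis using b by simp
  qed
  finally show ?thesis .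
qed

lemma exists_le_average:
  fixes f g :: "'a \<Rightarrow> real"
  assumes "finite P" "P \<noteq> {}" "(\<Sum>j\<in>P. f j) \<le> (\<Sum>j\<in>P. g j)"
  shows "\<exists>j\<in>P. f j \<le> g j"
  using assms sum_strict_mono[of P g f] by force

text \<open>The level is raised before the column is appended. Here \<open>\<eta>\<close> bounds the
  averaged frame constant, \<open>y\<close> bounds the averaged gap \<open>b' - s j\<close> from
  below, and \<open>\<eta> \<le> y * d\<close> makes the potential released by the raise cover the
  average of the second powers.\<close>

lemma barrier_step:
  assumes P: "finite P" "P \<noteq> {}" and T: "T \<subseteq> P" and sym: "\<And>i k. G i k = G k i"
    and diag: "\<And>j. j \<in> P \<Longrightarrow> G j j = 1" and frame: "frame_bound P G N" and "N \<ge> 0"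
    and bar: "barrier G T b S" and b: "b > 0" "d > 0" "b + d < 1"
    and \<eta>: "N * (1 + (b + d)) \<le> real (card P) * \<eta>"
    and y: "y > 0" "y \<le> b + d - \<eta> * S" "\<eta> \<le> y * d"
  shows "\<exists>j\<in>P - T. barrier G (insert j T) (b + d) (S + 1 / (b + d) + 1 / y)"
proof -
  define b' where "b' = b + d"
  have fin: "finite T" using P T finite_subset by auto
  have cardP: "real (card P) > 0" using P by (simp add: card_gt_0_iff)
  have b': "0 < b'" "b' < 1" using b by (auto simp: b'_def)
  have "0 \<le> real (card P) * \<eta>" using \<eta> b \<open>N \<ge> 0\<close> by (smt (verit) mult_nonneg_nonneg)
  then have \<eta>0: "\<eta> \<ge> 0" using cardP by (simp add: zero_le_mult_iff)
  have symU: "upper_gap G b i k = upper_gap G b k i" for b i k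
    using sym by (auto simp: upper_gap_def off_gram_def)
  have symL: "lower_gap G b i k = lower_gap G b k i" for b i k
    using sym by (auto simp: lower_gap_def off_gram_def)
  have shU: "upper_gap G b' i k = upper_gap G b i k + d * of_bool (i = k)" for i k
    by (simp add: b'_def upper_gap_def algebra_simps)
  have shL: "lower_gap G b' i k = lower_gap G b i k + d * of_bool (i = k)" for i k
    by (simp add: b'_def lower_gap_def algebra_simps)
  obtain B0 C0 where B0: "pos_inverse T (upper_gap G b) B0" and C0: "pos_inverse T (lower_gap G b) C0"
    and S0: "trace_on T B0 + trace_on T C0 \<le> S" using bar by (auto simp: barrier_def)
  obtain B where B: "pos_inverse T (upper_gap G b') B"
    and trB: "d * frob_on T B \<le> trace_on T B0 - trace_on T B"
    using pos_inverse_shift[OF fin B0 symU shU \<open>d > 0\<close>] by metis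
  obtain C where C: "pos_inverse T (lower_gap G b') C"
    and trC: "d * frob_on T C \<le> trace_on T C0 - trace_on T C"
    using pos_inverse_shift[OF fin C0 symL shL \<open>d > 0\<close>] by metis
  define S' where "S' = trace_on T B + trace_on T C"
  define A where "A = frob_on T B + frob_on T C"
  have A0: "A \<ge> 0" unfolding A_def frob_on_def by (simp add: sum_nonneg add_nonneg_nonneg)
  have S': "S' + d * A \<le> S" using trB trC S0 by (simp add: S'_def A_def algebra_simps)
  \<comment> \<open>The upper barrier at the raised level bounds the form of \<open>G\<close> on
    \<open>T\<close>, which turns the frame bound into the constant needed for averaging.\<close>
  have K: "(\<Sum>j\<in>P. (mvec T G x j)\<^sup>2) \<le> (real (card P) * \<eta>) * (\<Sum>i\<in>T. (x i)\<^sup>2)" for x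
  proof -
    have "qform T G x \<le> (1 + b') * (\<Sum>i\<in>T. (x i)\<^sup>2)"
      using pos_inverse_imp_psd[OF fin B symU] qform_upper_gap[OF fin, of G b' x]
      by (metis psd_on_def diff_ge_0_iff_ge)
    then have "N * qform T G x \<le> N * (1 + b') * (\<Sum>i\<in>T. (x i)\<^sup>2)"
      using \<open>N \<ge> 0\<close> by (simp add: mult_left_mono mult.assoc)
    also have "\<dots> \<le> (real (card P) * \<eta>) * (\<Sum>i\<in>T. (x i)\<^sup>2)"
      using \<eta> by (intro mult_right_mono) (auto simp: b'_def sum_nonneg)
    finally show ?thesis using frame T unfolding frame_bound_def by (meson order_trans)
  qed
  let ?v = "\<lambda>j k. G k j"
  define s where "s j = qform T B (?v j) + qform T C (?v j)" for j
  define a where "a j = (\<Sum>i\<in>T. (mvec T B (?v j) i)\<^sup>2) + (\<Sum>i\<in>T. (mvec T C (?v j) i)\<^sup>2)" for j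
  have sum_s: "(\<Sum>j\<in>P. s j) \<le> real (card P) * (\<eta> * S')"
    using sum_qform_le[OF fin P(1) B sym K] sum_qform_le[OF fin P(1) C sym K]
    by (simp add: s_def S'_def sum.distrib algebra_simps)
  have sum_a: "(\<Sum>j\<in>P. a j) \<le> real (card P) * (\<eta> * A)"
    using sum_mvec_squares_le[OF sym K, of B] sum_mvec_squares_le[OF sym K, of C]
    by (simp add: a_def A_def sum.distrib algebra_simps)
  \<comment> \<open>The term \<open>d * A\<close> is exactly the amount released by raising the
    level, so an increase of \<open>m\<close> over \<open>S'\<close> costs only \<open>1 / y\<close>
    over \<open>S\<close>.\<close>
  define m where "m = 1 / y + d * A"
  have m0: "m > 0" using y A0 b by (simp add: m_def add_pos_nonneg)
  \<comment> \<open>Linear in \<open>a\<close> and \<open>s\<close>, hence accessible to averaging, yet it bounds the potential increase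
    \<open>(1 + a j) / (b' - s j)\<close>.\<close>
  have "\<exists>j\<in>P. 1 + a j \<le> (b' - s j) * m"
  proof (rule exists_le_average[OF P])
    have "\<eta> * S' \<le> \<eta> * S" using S' A0 b \<eta>0 by (intro mult_left_mono) (smt (verit) mult_nonneg_nonneg)+
    then have "y \<le> b' - \<eta> * S'" using y by (simp add: b'_def)
    then have "y * m \<le> (b' - \<eta> * S') * m" using m0 by simp
    moreover have "y * m = 1 + y * d * A" using y by (simp add: m_def field_simps)
    moreover have "\<eta> * A \<le> y * d * A" using y A0 by (intro mult_right_mono)
    ultimately have "1 + \<eta> * A \<le> (b' - \<eta> * S') * m" by linarith
    then have main: "real (card P) * (1 + \<eta> * A) \<le> real (card P) * ((b' - \<eta> * S') * m)"
      by (intro mult_left_mono) auto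
    have "(\<Sum>j\<in>P. 1 + a j) \<le> real (card P) * (1 + \<eta> * A)"
      using sum_a by (simp add: sum.distrib algebra_simps)
    moreover have "real (card P) * ((b' - \<eta> * S') * m) \<le> (\<Sum>j\<in>P. (b' - s j) * m)"
    proof -
      have "real (card P) * (b' - \<eta> * S') \<le> (\<Sum>j\<in>P. b' - s j)"
        using sum_s by (simp add: sum_subtractf algebra_simps)
      then show ?thesis using m0 by (simp add: sum_distrib_right[symmetric] mult.assoc[symmetric])
    qed
    ultimately show "(\<Sum>j\<in>P. 1 + a j) \<le> (\<Sum>j\<in>P. (b' - s j) * m)" using main by linarith
  qed
  then obtain j where j: "j \<in> P" and jm: "1 + a j \<le> (b' - s j) * m" by auto
  have a0: "a j \<ge> 0" unfolding a_def by (simp add: sum_nonneg add_nonneg_nonneg)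
  have q0: "0 \<le> qform T B (?v j)" "0 \<le> qform T C (?v j)"
    using pos_inverse_qform_nonneg B C by blast+
  have sb: "s j < b'"
    using jm a0 m0 by (smt (verit) mult_nonpos_nonneg)
  have jT: "j \<notin> T"
    using qform_lower_inverse_ge_one[OF fin C sym _ diag[OF j]] b' sb q0 by (fastforce simp: s_def)
  have Uj: "upper_gap G b' j j = b'" "lower_gap G b' j j = b'"
    using diag[OF j] by (simp_all add: upper_gap_def lower_gap_def off_gram_def)
  \<comment> \<open>Since \<open>j\<close> is outside \<open>T\<close>, the bordering columns are
    column \<open>j\<close> of \<open>G\<close> up to sign, and the sign disappears in the form and
    in the squares.\<close>
  have colL: "lower_gap G b' k j = G k j" and colU: "upper_gap G b' k j = - G k j" if "k \<in> T" for k
    using that jT by (auto simp: upper_gap_def lower_gap_def off_gram_def)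
  have mvL: "mvec T C (\<lambda>k. lower_gap G b' k j) i = mvec T C (?v j) i" for i
    unfolding mvec_def using colL by (intro sum.cong) auto
  have mvU: "mvec T B (\<lambda>k. upper_gap G b' k j) i = - mvec T B (?v j) i" for i
    unfolding mvec_def sum_negf[symmetric] using colU by (intro sum.cong) auto
  have qL: "qform T C (\<lambda>k. lower_gap G b' k j) = qform T C (?v j)"
    unfolding qform_def mvL using colL by (intro sum.cong) auto
  have qU: "qform T B (\<lambda>k. upper_gap G b' k j) = qform T B (?v j)"
    unfolding qform_def mvU using colU by (intro sum.cong) auto
  obtain B' where B': "pos_inverse (insert j T) (upper_gap G b') B'"
    "trace_on (insert j T) B' = trace_on T B + (1 + (\<Sum>i\<in>T. (mvec T B (?v j) i)\<^sup>2)) / (b' - qform T B (?v j))"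
  proof (rule pos_inverse_insert[OF fin jT B symU])
    show "0 < upper_gap G b' j j - qform T B (\<lambda>k. upper_gap G b' k j)"
      using sb q0 by (simp add: qU Uj s_def)
  qed (use that in \<open>simp add: qU Uj mvU\<close>)
  obtain C' where C': "pos_inverse (insert j T) (lower_gap G b') C'"
    "trace_on (insert j T) C' = trace_on T C + (1 + (\<Sum>i\<in>T. (mvec T C (?v j) i)\<^sup>2)) / (b' - qform T C (?v j))"
  proof (rule pos_inverse_insert[OF fin jT C symL])
    show "0 < lower_gap G b' j j - qform T C (\<lambda>k. lower_gap G b' k j)"
      using sb q0 by (simp add: qL Uj s_def)
  qed (use that in \<open>simp add: qL Uj mvL\<close>)
  have "trace_on (insert j T) B' + trace_on (insert j T) C' \<le> S' + (1 / b' + (1 + a j) / (b' - s j))"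
    unfolding B'(2) C'(2) S'_def a_def s_def
    using two_sided_increment_le[OF q0, of b' "\<Sum>i\<in>T. (mvec T B (?v j) i)\<^sup>2" "\<Sum>i\<in>T. (mvec T C (?v j) i)\<^sup>2"] sb
    by (simp add: s_def sum_nonneg)
  also have "(1 + a j) / (b' - s j) \<le> m" using jm sb by (simp add: field_simps)
  also have "S' + (1 / b' + m) \<le> S + 1 / b' + 1 / y" using S' by (simp add: m_def)
  finally have "barrier G (insert j T) b' (S + 1 / b' + 1 / y)"
    unfolding barrier_def using B'(1) C'(1) by auto
  then show ?thesis using j jT unfolding b'_def by blast
qed

lemma barrier_mono: "barrier G T b S \<Longrightarrow> S \<le> S' \<Longrightarrow> barrier G T b S'"
  unfolding barrier_def by force

text \<open>\<open>barrier_step\<close> is iterated with \<open>y = 4 * \<epsilon> / 9\<close>; the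
  size hypothesis is then \<open>\<eta> \<le> y * d\<close>. The final level is
  \<open>\<epsilon>\<close>.\<close>

lemma column_selection_barrier:
  assumes P: "finite P" "P \<noteq> {}" and sym: "\<And>i k. G i k = G k i"
    and diag: "\<And>j. j \<in> P \<Longrightarrow> G j j = 1" and frame: "frame_bound P G N" and "N \<ge> 0"
    and \<epsilon>: "0 < \<epsilon>" "\<epsilon> < 1" and R: "R > 0"
    and size: "27 * real R * (N * (1 + \<epsilon>)) \<le> 4 * \<epsilon>\<^sup>2 * real (card P)"
  shows "\<exists>T\<subseteq>P. card T = R \<and> psd_on T (upper_gap G \<epsilon>) \<and> psd_on T (lower_gap G \<epsilon>)"
proof -
  \<comment> \<open>\<open>R\<close> steps of this size raise the level by
    \<open>\<epsilon> / 3\<close>.\<close>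
  define d where "d = \<epsilon> / (3 * real R)"
  define \<eta> where "\<eta> = N * (1 + \<epsilon>) / real (card P)"
  \<comment> \<open>The potential allowed per step: \<open>1 / y = 9 / (4 * \<epsilon>)\<close> plus
    \<open>3 / (2 * \<epsilon>)\<close>, the reciprocal of the lowest level.\<close>
  define L where "L = 15 / (4 * \<epsilon>)"
  define lev where "lev r = 2 * \<epsilon> / 3 + real r * d" for r
  have cardP: "real (card P) > 0" using P by (simp add: card_gt_0_iff)
  have d0: "d > 0" using \<epsilon> R by (simp add: d_def)
  have \<eta>0: "\<eta> \<ge> 0" using \<epsilon> \<open>N \<ge> 0\<close> by (simp add: \<eta>_def)
  have \<eta>R: "27 * real R * \<eta> \<le> 4 * \<epsilon>\<^sup>2"
    using size cardP by (simp add: \<eta>_def field_simps)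
  have "\<exists>T\<subseteq>P. card T = r \<and> barrier G T (lev r) (real r * L)" if "r \<le> R" for r
    using that
  proof (induction r)
    case 0
    have "barrier G {} (lev 0) 0" by (auto simp: barrier_def pos_inverse_def trace_on_def)
    then show ?case by (intro exI[of _ "{}"]) simp
  next
    case (Suc r)
    then obtain T where T: "T \<subseteq> P" "card T = r" and bar: "barrier G T (lev r) (real r * L)" by auto
    have Rd: "real R * d = \<epsilon> / 3" using R by (simp add: d_def)
    have lev_Suc: "lev r + d = lev (Suc r)" by (simp add: lev_def algebra_simps)
    have "real (Suc r) * d \<le> real R * d" using Suc.prems d0 by (intro mult_right_mono) auto
    then have lev_le: "lev r + d \<le> \<epsilon>" unfolding lev_Suc lev_def Rd by (simp add: algebra_simps)
    have lev_ge: "2 * \<epsilon> / 3 \<le> lev r" using d0 by (simp add: lev_def)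
    have y3: "\<eta> \<le> 4 * \<epsilon> / 9 * d"
      using \<eta>R R by (simp add: d_def field_simps power2_eq_square)
    \<comment> \<open>Split \<open>L\<close> into its two shares: the share
      \<open>9 / (4 * \<epsilon>)\<close> costs at most \<open>r * d\<close>, which is the rise of
      the level so far, and the other at most \<open>2 * \<epsilon> / 9\<close>. What remains of
      \<open>2 * \<epsilon> / 3\<close> is \<open>4 * \<epsilon> / 9\<close>.\<close>
    have y2: "4 * \<epsilon> / 9 \<le> lev r + d - \<eta> * (real r * L)"
    proof -
      have "\<eta> * (9 / (4 * \<epsilon>)) \<le> d" using y3 \<epsilon> by (simp add: field_simps)
      then have "real r * (\<eta> * (9 / (4 * \<epsilon>))) \<le> real r * d" by (intro mult_left_mono) auto
      moreover have "real r * \<eta> \<le> real R * \<eta>" using Suc.prems \<eta>0 by (intro mult_right_mono) auto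
      then have "27 * (real r * \<eta>) \<le> 4 * \<epsilon>\<^sup>2" using \<eta>R by simp
      then have "real r * (\<eta> * (3 / (2 * \<epsilon>))) \<le> 2 * \<epsilon> / 9"
        using \<epsilon> by (simp add: field_simps power2_eq_square)
      moreover have "\<eta> * (real r * L) = real r * (\<eta> * (9 / (4 * \<epsilon>))) + real r * (\<eta> * (3 / (2 * \<epsilon>)))"
        using \<epsilon> by (simp add: L_def field_simps)
      ultimately show ?thesis using d0 unfolding lev_def by linarith
    qed
    have "N * (1 + (lev r + d)) \<le> N * (1 + \<epsilon>)" using lev_le \<open>N \<ge> 0\<close> by (intro mult_left_mono) auto
    also have "\<dots> = real (card P) * \<eta>" using cardP by (simp add: \<eta>_def)
    finally have "\<exists>j\<in>P - T. barrier G (insert j T) (lev r + d) (real r * L + 1 / (lev r + d) + 1 / (4 * \<epsilon> / 9))"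
      using lev_ge lev_le \<epsilon> d0
      by (intro barrier_step[OF P T(1) sym diag frame \<open>N \<ge> 0\<close> bar _ d0 _ _ _ y2 y3]) auto
    then obtain j where j: "j \<in> P" "j \<notin> T"
      and bj: "barrier G (insert j T) (lev (Suc r)) (real r * L + 1 / lev (Suc r) + 1 / (4 * \<epsilon> / 9))"
      unfolding lev_Suc by auto
    have "1 / lev (Suc r) \<le> 1 / (2 * \<epsilon> / 3)"
      using lev_ge d0 \<epsilon> unfolding lev_Suc[symmetric] by (intro divide_left_mono) auto
    then have "real r * L + 1 / lev (Suc r) + 1 / (4 * \<epsilon> / 9) \<le> real r * L + 1 / (2 * \<epsilon> / 3) + 1 / (4 * \<epsilon> / 9)"
      by simp
    also have "\<dots> = real (Suc r) * L" using \<epsilon> by (simp add: L_def field_simps)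
    finally have "barrier G (insert j T) (lev (Suc r)) (real (Suc r) * L)"
      using bj barrier_mono by blast
    moreover have "card (insert j T) = Suc r"
      using j T P finite_subset by (metis card_insert_disjoint)
    ultimately show ?case using j T by (intro exI[of _ "insert j T"]) auto
  qed
  then obtain T where T: "T \<subseteq> P" "card T = R" "barrier G T (lev R) (real R * L)" by blast
  have "lev R = \<epsilon>" using R by (simp add: lev_def d_def)
  moreover have "finite T" using T P finite_subset by auto
  ultimately show ?thesis
    using T unfolding barrier_def
    by (intro exI[of _ T]) (auto intro!: pos_inverse_imp_psd simp: upper_gap_def lower_gap_def off_gram_def sym)
qed

subsection \<open>Few columns\<close>

text \<open>Cauchy-Schwarz for \<open>H\<close> against \<open>x x^T\<close>, obtained entrywise
  from a weighted AM-GM inequality.\<close>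

lemma abs_qform_le_frob:
  assumes fin: "finite T" and F: "frob_on T H \<le> \<epsilon>\<^sup>2" and "\<epsilon> > 0"
  shows "\<bar>qform T H x\<bar> \<le> \<epsilon> * (\<Sum>i\<in>T. (x i)\<^sup>2)"
proof -
  define s where "s = (\<Sum>i\<in>T. (x i)\<^sup>2)"
  have s0: "s \<ge> 0" by (simp add: s_def sum_nonneg)
  show ?thesis
  proof (cases "s = 0")
    case True
    then have "\<forall>i\<in>T. x i = 0" using fin by (simp add: s_def sum_nonneg_eq_0_iff)
    then show ?thesis by (simp add: qform_def)
  next
    case False
    then have sp: "s > 0" using s0 by simp
    \<comment> \<open>This weight balances the two terms: \<open>t * \<epsilon>^2\<close> and
      \<open>s^2 / t\<close> both equal \<open>\<epsilon> * s\<close>.\<close>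
    define t where "t = s / \<epsilon>"
    have tp: "t > 0" using sp \<open>\<epsilon> > 0\<close> by (simp add: t_def)
    have amgm: "\<bar>h * z\<bar> \<le> (t * h\<^sup>2 + z\<^sup>2 / t) / 2" for h z
    proof -
      have "0 \<le> (t * \<bar>h\<bar> - \<bar>z\<bar>)\<^sup>2 / t" using tp by simp
      also have "\<dots> = t * h\<^sup>2 + z\<^sup>2 / t - 2 * \<bar>h * z\<bar>"
        using tp by (simp add: power2_eq_square field_simps abs_mult)
      finally show ?thesis by simp
    qed
    have ss: "s\<^sup>2 = (\<Sum>i\<in>T. \<Sum>k\<in>T. (x i * x k)\<^sup>2)"
      by (simp add: s_def power2_eq_square[of "sum _ _"] sum_product power_mult_distrib)
    have "\<bar>qform T H x\<bar> \<le> (\<Sum>i\<in>T. \<Sum>k\<in>T. \<bar>H i k * (x i * x k)\<bar>)"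
      unfolding qform_alt
      by (rule order_trans[OF sum_abs sum_mono], rule order_trans[OF sum_abs]) (simp add: mult_ac)
    also have "\<dots> \<le> (\<Sum>i\<in>T. \<Sum>k\<in>T. (t * (H i k)\<^sup>2 + (x i * x k)\<^sup>2 / t) / 2)"
      by (intro sum_mono amgm)
    also have "\<dots> = (t * frob_on T H + s\<^sup>2 / t) / 2"
      unfolding ss by (simp add: frob_on_def sum.distrib sum_distrib_left sum_divide_distrib add_divide_distrib)
    also have "\<dots> \<le> (t * \<epsilon>\<^sup>2 + s\<^sup>2 / t) / 2" using F tp by simp
    also have "\<dots> = \<epsilon> * s" using sp \<open>\<epsilon> > 0\<close> by (simp add: t_def power2_eq_square field_simps)
    finally show ?thesis by (simp add: s_def)
  qed
qed

text \<open>The new row and column contribute equally, and the new diagonal entry vanishes since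
  \<open>G j j = 1\<close>.\<close>

lemma frob_on_insert_off_gram:
  assumes fin: "finite T" and j: "j \<notin> T" "G j j = 1" and sym: "\<And>i k. G i k = G k i"
  shows "frob_on (insert j T) (off_gram G) = frob_on T (off_gram G) + 2 * (\<Sum>i\<in>T. (G i j)\<^sup>2)"
proof -
  have 1: "(\<Sum>i\<in>T. (off_gram G i j)\<^sup>2) = (\<Sum>i\<in>T. (G i j)\<^sup>2)"
    using j by (intro sum.cong) (auto simp: off_gram_def)
  have 2: "(\<Sum>i\<in>T. (off_gram G j i)\<^sup>2) = (\<Sum>i\<in>T. (G i j)\<^sup>2)"
    using j sym by (intro sum.cong) (auto simp: off_gram_def)
  show ?thesis
    using fin j 1 2 by (simp add: frob_on_def sum.distrib) (simp add: off_gram_def)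
qed

text \<open>Some column adds at most the average \<open>2 * r * \<eta>\<close> to the squared
  Frobenius norm, and \<open>r * (r - 1) + 2 * r = (r + 1) * r\<close>.\<close>

lemma column_selection_frobenius:
  assumes P: "finite P" "P \<noteq> {}" and sym: "\<And>i k. G i k = G k i"
    and diag: "\<And>j. j \<in> P \<Longrightarrow> G j j = 1" and frame: "frame_bound P G N" and "N \<ge> 0"
    and \<epsilon>: "0 < \<epsilon>" "\<epsilon> < 1"
    and size: "real R * (real R - 1) * N \<le> \<epsilon>\<^sup>2 * real (card P)"
  shows "\<exists>T\<subseteq>P. card T = R \<and> psd_on T (upper_gap G \<epsilon>) \<and> psd_on T (lower_gap G \<epsilon>)"
proof -
  define \<eta> where "\<eta> = N / real (card P)"
  have cardP: "real (card P) > 0" using P by (simp add: card_gt_0_iff)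
  have \<eta>0: "\<eta> \<ge> 0" using \<open>N \<ge> 0\<close> by (simp add: \<eta>_def)
  have \<eta>R: "real R * (real R - 1) * \<eta> \<le> \<epsilon>\<^sup>2"
    using size cardP by (simp add: \<eta>_def field_simps)
  have "\<exists>T\<subseteq>P. card T = r \<and> frob_on T (off_gram G) \<le> real r * (real r - 1) * \<eta>" if "r \<le> R" for r
    using that
  proof (induction r)
    case 0
    show ?case by (intro exI[of _ "{}"]) (simp add: frob_on_def)
  next
    case (Suc r)
    then obtain T where T: "T \<subseteq> P" "card T = r"
      and F: "frob_on T (off_gram G) \<le> real r * (real r - 1) * \<eta>" by auto
    have fin: "finite T" using T P finite_subset by auto
    have "(\<Sum>j\<in>P. \<Sum>i\<in>T. (G i j)\<^sup>2) = (\<Sum>i\<in>T. \<Sum>j\<in>P. (G i j)\<^sup>2)" by (rule sum.swap)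
    also have "\<dots> \<le> (\<Sum>i\<in>T. N)"
    \<comment> \<open>The frame bound for a single index says that a row of \<open>G\<close> has
      squared norm at most \<open>N\<close>.\<close>
    proof (rule sum_mono)
      fix i assume i: "i \<in> T"
      have "mvec {i} G (\<lambda>_. 1) j = G i j" for j using sym[of i j] by (simp add: mvec_def)
      moreover have "qform {i} G (\<lambda>_. 1) = 1" using diag i T by (auto simp: mvec_def qform_def)
      ultimately show "(\<Sum>j\<in>P. (G i j)\<^sup>2) \<le> N"
        using frame[unfolded frame_bound_def, rule_format, of "{i}" "\<lambda>_. 1"] i T by auto
    qed
    also have "\<dots> = (\<Sum>j\<in>P. real r * \<eta>)" using T cardP by (simp add: \<eta>_def)
    finally obtain j where j: "j \<in> P" and jr: "(\<Sum>i\<in>T. (G i j)\<^sup>2) \<le> real r * \<eta>"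
      using exists_le_average[OF P] by blast
    \<comment> \<open>A selected column would contribute its own diagonal entry 1 to the sum, so a
      bound below 1 forces a new column.\<close>
    have small: "real r * \<eta> < 1"
    proof (cases "r = 0")
      case False
      have "1 * (real r * \<eta>) \<le> real (Suc r) * (real r * \<eta>)"
        using \<eta>0 by (intro mult_right_mono) auto
      also have "\<dots> \<le> real R * ((real R - 1) * \<eta>)"
        using Suc.prems \<eta>0 by (intro mult_mono mult_right_mono) auto
      also have "\<dots> \<le> \<epsilon>\<^sup>2" using \<eta>R by (simp add: mult.assoc)
      also have "\<dots> < 1" using \<epsilon> by (simp add: power_less_one_iff)
      finally show ?thesis by simp
    qed simp
    have jT: "j \<notin> T"
    proof
      assume "j \<in> T"
      then have "(G j j)\<^sup>2 \<le> (\<Sum>i\<in>T. (G i j)\<^sup>2)" using fin by (intro member_le_sum) auto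
      then show False using jr small diag[OF j] by simp
    qed
    have "frob_on (insert j T) (off_gram G) \<le> real r * (real r - 1) * \<eta> + 2 * (real r * \<eta>)"
      using frob_on_insert_off_gram[of T j G] fin jT diag[OF j] sym F jr by fastforce
    also have "\<dots> = real (Suc r) * (real (Suc r) - 1) * \<eta>" by (simp add: algebra_simps)
    finally show ?case using j jT T fin by (intro exI[of _ "insert j T"]) auto
  qed
  then obtain T where T: "T \<subseteq> P" "card T = R" "frob_on T (off_gram G) \<le> real R * (real R - 1) * \<eta>"
    by blast
  have fin: "finite T" using T P finite_subset by auto
  have q: "qform T G x = qform T (off_gram G) x + 1 * (\<Sum>i\<in>T. (x i)\<^sup>2)" for x
    by (rule qform_add_scalar) (auto simp: fin off_gram_def)
  have "frob_on T (off_gram G) \<le> \<epsilon>\<^sup>2" using T \<eta>R by simp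
  from abs_qform_le_frob[OF fin this \<epsilon>(1)] have H: "\<bar>qform T (off_gram G) x\<bar> \<le> \<epsilon> * (\<Sum>i\<in>T. (x i)\<^sup>2)" for x .
  have "0 \<le> qform T (upper_gap G \<epsilon>) x" "0 \<le> qform T (lower_gap G \<epsilon>) x" for x
    using H[of x] unfolding qform_upper_gap[OF fin] qform_lower_gap[OF fin] q by (auto simp: algebra_simps)
  then show ?thesis using T by (auto simp: psd_on_def)
qed

subsection \<open>Gram matrices\<close>

definition gram :: "nat \<Rightarrow> (nat \<Rightarrow> 'a \<Rightarrow> real) \<Rightarrow> 'a \<Rightarrow> 'a \<Rightarrow> real" where
  "gram n X i k = (\<Sum>l<n. X l i * X l k)"

lemma gram_sym: "gram n X i k = gram n X k i"
  by (simp add: gram_def mult.commute)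

lemma mvec_gram: "mvec T (gram n X) x j = (\<Sum>l<n. X l j * (\<Sum>k\<in>T. X l k * x k))"
  unfolding mvec_def gram_def sum_distrib_left sum_distrib_right mult.assoc by (rule sum.swap)

lemma qform_gram: "qform T (gram n X) x = (\<Sum>l<n. (\<Sum>k\<in>T. X l k * x k)\<^sup>2)"
proof -
  have "qform T (gram n X) x = (\<Sum>i\<in>T. \<Sum>l<n. X l i * x i * (\<Sum>k\<in>T. X l k * x k))"
    unfolding qform_def mvec_gram sum_distrib_left by (intro sum.cong) (auto simp: mult_ac)
  also have "\<dots> = (\<Sum>l<n. \<Sum>i\<in>T. X l i * x i * (\<Sum>k\<in>T. X l k * x k))" by (rule sum.swap)
  finally show ?thesis by (simp add: power2_eq_square sum_distrib_right)
qed

text \<open>The bound on \<open>X\<close> is transferred to its transpose. With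
  \<open>y = X x\<close> and \<open>w = X^T y\<close>, the squared norm of \<open>w\<close> is the
  inner product of \<open>y\<close> and \<open>X w\<close>. AM-GM with weight \<open>N\<close>
  bounds it by half of \<open>N |y|^2 + |w|^2\<close>, and the term in \<open>w\<close> is absorbed
  on the left.\<close>

lemma frame_bound_gram:
  assumes fin: "finite P" and "N > 0"
    and X: "\<And>w. (\<Sum>l<n. (\<Sum>j\<in>P. X l j * w j)\<^sup>2) \<le> N * (\<Sum>j\<in>P. (w j)\<^sup>2)"
  shows "frame_bound P (gram n X) N"
  unfolding frame_bound_def
proof (intro allI impI)
  fix T and x :: "'a \<Rightarrow> real" assume "T \<subseteq> P"
  define y where "y l = (\<Sum>k\<in>T. X l k * x k)" for l
  define w where "w j = mvec T (gram n X) x j" for j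
  define z where "z l = (\<Sum>j\<in>P. X l j * w j)" for l
  have "(\<Sum>j\<in>P. (w j)\<^sup>2) = (\<Sum>j\<in>P. \<Sum>l<n. w j * (X l j * y l))"
    by (simp add: power2_eq_square) (simp add: w_def[of "_::'a"] mvec_gram y_def sum_distrib_left)
  also have "\<dots> = (\<Sum>l<n. y l * z l)"
    unfolding z_def sum_distrib_left by (subst sum.swap) (simp add: mult_ac)
  also have "\<dots> \<le> (\<Sum>l<n. (N * (y l)\<^sup>2 + (z l)\<^sup>2 / N) / 2)"
  proof (rule sum_mono)
    fix l
    have "0 \<le> (N * y l - z l)\<^sup>2 / N" using \<open>N > 0\<close> by simp
    also have "\<dots> = N * (y l)\<^sup>2 + (z l)\<^sup>2 / N - 2 * (y l * z l)"
      using \<open>N > 0\<close> by (simp add: power2_eq_square field_simps)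
    finally show "y l * z l \<le> (N * (y l)\<^sup>2 + (z l)\<^sup>2 / N) / 2" by simp
  qed
  also have "\<dots> = (N * (\<Sum>l<n. (y l)\<^sup>2) + (\<Sum>l<n. (z l)\<^sup>2) / N) / 2"
    by (simp add: sum.distrib sum_distrib_left sum_divide_distrib add_divide_distrib)
  also have "(\<Sum>l<n. (z l)\<^sup>2) / N \<le> (\<Sum>j\<in>P. (w j)\<^sup>2)"
    using X[of w] \<open>N > 0\<close> by (simp add: z_def field_simps)
  finally show "(\<Sum>j\<in>P. (mvec T (gram n X) x j)\<^sup>2) \<le> N * qform T (gram n X) x"
    by (simp add: w_def y_def qform_gram)
qed

section \<open>Numerical bounds on logarithms\<close>

lemma two_le_ln_8: "2 \<le> ln (8::real)"
proof -
  \<comment> \<open>Equivalently \<open>exp 2 \<le> 8\<close>: the thirtieth power of this bound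
    gives \<open>exp 2 \<le> (15 / 14)^30\<close>, which is below 8.\<close>
  have "14 / 15 \<le> exp (- (1 / 15) :: real)" using exp_ge_add_one_self[of "- (1 / 15) :: real"] by simp
  then have "(14 / 15) ^ 30 \<le> exp (- (1 / 15) :: real) ^ 30" by (intro power_mono) auto
  also have "\<dots> = inverse (exp 2)" by (simp add: exp_of_nat_mult[symmetric] exp_minus[symmetric])
  finally have "inverse (inverse (exp 2)) \<le> inverse ((14 / 15) ^ 30 :: real)" by (intro le_imp_inverse_le) auto
  then have "exp 2 \<le> inverse ((14 / 15) ^ 30 :: real)" by simp
  also have "\<dots> \<le> 8" by (simp add: power_divide)
  finally show ?thesis by (simp add: ln_ge_iff)
qed

lemma pred_le_4_ln:
  assumes "0 < R" "R < 8"
  shows "real R - 1 \<le> 4 * ln (real R)"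
proof -
  have "ln (8::real) = 3 * ln 2" using ln_realpow[of 2 3] by simp
  then have ln2: "2 / 3 \<le> ln (2::real)" using two_le_ln_8 by simp
  have "ln (4::real) = 2 * ln 2" using ln_realpow[of 2 2] by simp
  then have ln4: "4 / 3 \<le> ln (4::real)" using ln2 by simp
  \<comment> \<open>For \<open>R = 7\<close> the bound inherited from \<open>ln 4\<close> is too
    weak, as \<open>4 * (4 / 3) < 6\<close>; comparing \<open>2^5\<close> with \<open>7^2\<close>
    gives \<open>5 / 3\<close>.\<close>
  have "5 * ln (2::real) = ln 32" "2 * ln (7::real) = ln 49"
    using ln_realpow[of 2 5] ln_realpow[of 7 2] by simp_all
  moreover have "ln (32::real) \<le> ln 49" by simp
  ultimately have ln7: "5 / 3 \<le> ln (7::real)" using ln2 by linarith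
  have "2 / 3 \<le> ln (3::real)" "4 / 3 \<le> ln (5::real)" "4 / 3 \<le> ln (6::real)"
    using order_trans[OF ln2, of "ln 3"] order_trans[OF ln4, of "ln 5"] order_trans[OF ln4, of "ln 6"]
    by simp_all
  note bounds = this ln2 ln4 ln7
  consider "R = 1" | "R = 2" | "R = 3" | "R = 4" | "R = 5" | "R = 6" | "R = 7" using assms by linarith
  then show ?thesis using bounds by cases auto
qed

text \<open>The hypothesis provides the factor \<open>4 * ln R\<close>. The Frobenius selection
  needs \<open>R - 1\<close> there and the barrier selection needs \<open>27 / 4\<close>; the split
  at 8 makes one of them available.\<close>

lemma gram_column_selection:
  fixes X :: "nat \<Rightarrow> 'a \<Rightarrow> real"
  assumes P: "finite P" "P \<noteq> {}" and unit: "\<And>j. j \<in> P \<Longrightarrow> (\<Sum>l<n. (X l j)\<^sup>2) = 1"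
    and "N > 0" and X: "\<And>w. (\<Sum>l<n. (\<Sum>j\<in>P. X l j * w j)\<^sup>2) \<le> N * (\<Sum>j\<in>P. (w j)\<^sup>2)"
    and \<epsilon>: "0 < \<epsilon>" "\<epsilon> < 1" and R: "R > 0"
    and size: "real R * ln (real R) \<le> \<epsilon>\<^sup>2 / (4 * (1 + \<epsilon>)) * (real (card P) / N)"
  obtains T where "T \<subseteq> P" "card T = R"
    "\<And>x. (1 - \<epsilon>) * (\<Sum>i\<in>T. (x i)\<^sup>2) \<le> (\<Sum>l<n. (\<Sum>k\<in>T. X l k * x k)\<^sup>2)"
    "\<And>x. (\<Sum>l<n. (\<Sum>k\<in>T. X l k * x k)\<^sup>2) \<le> (1 + \<epsilon>) * (\<Sum>i\<in>T. (x i)\<^sup>2)"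
proof -
  define G where "G = gram n X"
  have sym: "G i k = G k i" for i k unfolding G_def by (rule gram_sym)
  have diag: "G j j = 1" if "j \<in> P" for j
    using unit[OF that] by (simp add: G_def gram_def power2_eq_square)
  have frame: "frame_bound P G N" unfolding G_def by (rule frame_bound_gram[OF P(1) \<open>N > 0\<close> X])
  have size': "4 * ln (real R) * (real R * (N * (1 + \<epsilon>))) \<le> \<epsilon>\<^sup>2 * real (card P)"
  proof -
    have "real R * ln (real R) \<le> \<epsilon>\<^sup>2 * real (card P) / (4 * (1 + \<epsilon>) * N)" using size by simp
    then show ?thesis using \<open>N > 0\<close> \<epsilon> by (simp add: pos_le_divide_eq mult_ac)
  qed
  have "\<exists>T\<subseteq>P. card T = R \<and> psd_on T (upper_gap G \<epsilon>) \<and> psd_on T (lower_gap G \<epsilon>)"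
  proof (cases "R < 8")
    case True
    have "(real R - 1) * (real R * (N * 1)) \<le> 4 * ln (real R) * (real R * (N * (1 + \<epsilon>)))"
      using R pred_le_4_ln[OF R True] \<open>N > 0\<close> \<epsilon> by (intro mult_mono) auto
    then have "real R * (real R - 1) * N \<le> \<epsilon>\<^sup>2 * real (card P)" using size' by (simp add: mult_ac)
    then show ?thesis
      using column_selection_frobenius[OF P sym diag frame _ \<epsilon>] \<open>N > 0\<close> by simp
  next
    case False
    then have "ln 8 \<le> ln (real R)" by simp
    then have "27 / 4 \<le> 4 * ln (real R)" using two_le_ln_8 by linarith
    then have "27 / 4 * (real R * (N * (1 + \<epsilon>))) \<le> 4 * ln (real R) * (real R * (N * (1 + \<epsilon>)))"
      using \<open>N > 0\<close> \<epsilon> by (intro mult_right_mono) auto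
    then have "27 * real R * (N * (1 + \<epsilon>)) \<le> 4 * \<epsilon>\<^sup>2 * real (card P)" using size' by simp
    then show ?thesis
      using column_selection_barrier[OF P sym diag frame _ \<epsilon> R] \<open>N > 0\<close> by simp
  qed
  then obtain T where T: "T \<subseteq> P" "card T = R" "psd_on T (upper_gap G \<epsilon>)" "psd_on T (lower_gap G \<epsilon>)"
    by blast
  have fin: "finite T" using T P finite_subset by auto
  show ?thesis
    using that[OF T(1,2)] T(3,4)
    unfolding psd_on_def qform_upper_gap[OF fin] qform_lower_gap[OF fin] G_def qform_gram by simp
qed

subsection \<open>Eigenvalues and operator norm\<close>

text \<open>This makes the set of eigenvalues nonempty. A complex eigenvalue \<open>\<mu>\<close>
  with eigenvector \<open>z\<close> exists; the Hermitian form of \<open>A\<close> at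
  \<open>z\<close> is real and equals \<open>\<mu>\<close> times the squared norm of
  \<open>z\<close>, so \<open>\<mu>\<close> is real and a root of the real characteristic
  polynomial.\<close>

lemma symmetric_real_eigenvalue_exists:
  fixes A :: "real mat"
  assumes A: "A \<in> carrier_mat m m" and "m > 0" and sym: "A\<^sup>T = A"
  shows "\<exists>k. eigenvalue A k"
proof -
  let ?A = "map_mat complex_of_real A"
  have cA: "?A \<in> carrier_mat m m" using A by simp
  obtain \<mu> where ev: "eigenvalue ?A \<mu>"
    using spectrum_non_empty[OF cA \<open>m > 0\<close>] by (auto simp: spectrum_def)
  then obtain z where z: "z \<in> carrier_vec m" "z \<noteq> 0\<^sub>v m" "?A *\<^sub>v z = \<mu> \<cdot>\<^sub>v z"
    using A by (auto simp: eigenvalue_def eigenvector_def)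
  define a where "a i k = complex_of_real (A $$ (i, k))" for i k
  have a: "a i k = a k i" "cnj (a i k) = a i k" if "i < m" "k < m" for i k
    using that A arg_cong[OF sym, of "\<lambda>B. B $$ (i, k)"] by (auto simp: a_def)
  have row: "(\<Sum>k<m. a i k * z $ k) = \<mu> * z $ i" if "i < m" for i
  proof -
    have "(?A *\<^sub>v z) $ i = (\<Sum>k<m. a i k * z $ k)"
      using that A z(1) by (auto simp: scalar_prod_def a_def atLeast0LessThan intro!: sum.cong)
    then show ?thesis using z that by simp
  qed
  define S where "S = (\<Sum>i<m. cnj (z $ i) * (\<Sum>k<m. a i k * z $ k))"
  define s where "s = (\<Sum>i<m. (cmod (z $ i))\<^sup>2)"
  have "cnj (z $ i) * (\<Sum>k<m. a i k * z $ k) = \<mu> * complex_of_real ((cmod (z $ i))\<^sup>2)" if "i < m" for i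
    unfolding row[OF that] complex_norm_square by (simp add: mult_ac)
  then have "S = (\<Sum>i<m. \<mu> * complex_of_real ((cmod (z $ i))\<^sup>2))"
    unfolding S_def by (intro sum.cong) auto
  then have S: "S = \<mu> * complex_of_real s" by (simp add: s_def sum_distrib_left)
  have "cnj S = (\<Sum>i<m. \<Sum>k<m. z $ i * (a i k * cnj (z $ k)))"
    using a by (simp add: S_def sum_distrib_left)
  also have "\<dots> = (\<Sum>k<m. \<Sum>i<m. z $ i * (a i k * cnj (z $ k)))" by (rule sum.swap)
  also have "\<dots> = S"
    unfolding S_def sum_distrib_left using a by (intro sum.cong) (auto simp: mult_ac)
  finally have "cnj S = S" .
  moreover have "s \<noteq> 0"
  proof
    assume "s = 0"
    then have "\<forall>i<m. z $ i = 0" by (simp add: s_def sum_nonneg_eq_0_iff)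
    then have "z = 0\<^sub>v m" using z(1) by (intro eq_vecI) auto
    then show False using z by simp
  qed
  ultimately have "cnj \<mu> = \<mu>" by (simp add: S)
  then have \<mu>: "\<mu> = complex_of_real (Re \<mu>)" by (simp add: complex_eq_iff)
  have "poly (char_poly ?A) \<mu> = 0" using ev eigenvalue_root_char_poly[OF cA] by simp
  then have "poly (map_poly complex_of_real (char_poly A)) (complex_of_real (Re \<mu>)) = 0"
    using \<mu> of_real_hom.char_poly_hom[OF A] by metis
  then have "poly (char_poly A) (Re \<mu>) = 0" by simp
  then show ?thesis using eigenvalue_root_char_poly[OF A] by blast
qed

lemma finite_eigenvalues:
  fixes A :: "'a :: field mat"
  assumes A: "A \<in> carrier_mat m m"
  shows "finite {k. eigenvalue A k}"
proof -
  have "char_poly A \<noteq> 0" using degree_monic_char_poly[OF A] by auto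
  then show ?thesis unfolding eigenvalue_root_char_poly[OF A] by (rule poly_roots_finite)
qed

section \<open>Euclidean norm and operator norm\<close>

lemma vnorm_square_scalar_prod: "(vnorm v)\<^sup>2 = v \<bullet> v"
  by (simp add: vnorm_def scalar_prod_def sum_nonneg)

lemma vnorm_square: "(vnorm v)\<^sup>2 = (\<Sum>i<dim_vec v. (v $ i)\<^sup>2)"
  unfolding vnorm_square_scalar_prod by (simp add: scalar_prod_def power2_eq_square atLeast0LessThan)

lemma vnorm_nonneg: "0 \<le> vnorm v"
  by (simp add: vnorm_def scalar_prod_def sum_nonneg)

lemma mult_mat_vec_index:
  assumes "X \<in> carrier_mat n p" "v \<in> carrier_vec p" "l < n"
  shows "(X *\<^sub>v v) $ l = (\<Sum>j<p. X $$ (l, j) * v $ j)"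
  using assms by (auto simp: scalar_prod_def atLeast0LessThan intro!: sum.cong)

lemma vnorm_mult_square:
  assumes X: "X \<in> carrier_mat n p" and v: "v \<in> carrier_vec p"
  shows "(vnorm (X *\<^sub>v v))\<^sup>2 = (\<Sum>l<n. (\<Sum>j<p. X $$ (l, j) * v $ j)\<^sup>2)"
proof -
  have "dim_vec (X *\<^sub>v v) = n" using X by simp
  then show ?thesis unfolding vnorm_square by (simp add: mult_mat_vec_index[OF X v] del: index_mult_mat_vec)
qed

text \<open>The supremum is meaningful only for a bounded set; entries of a unit vector are at most
  1 in modulus, so absolute row sums give a bound.\<close>

lemma vnorm_mult_le_op_norm:
  assumes X: "X \<in> carrier_mat n p" and v: "v \<in> carrier_vec p" "vnorm v = 1"
  shows "vnorm (X *\<^sub>v v) \<le> op_norm X"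
  unfolding op_norm_def
proof (rule cSup_upper)
  show "vnorm (X *\<^sub>v v) \<in> {vnorm (X *\<^sub>v v) |v. v \<in> carrier_vec (dim_col X) \<and> vnorm v = 1}"
    using X v by auto
  show "bdd_above {vnorm (X *\<^sub>v v) |v. v \<in> carrier_vec (dim_col X) \<and> vnorm v = 1}"
  proof (rule bdd_aboveI)
    fix b assume "b \<in> {vnorm (X *\<^sub>v v) |v. v \<in> carrier_vec (dim_col X) \<and> vnorm v = 1}"
    then obtain u where u: "u \<in> carrier_vec p" "vnorm u = 1" "b = vnorm (X *\<^sub>v u)" using X by auto
    have entry: "\<bar>u $ j\<bar> \<le> 1" if "j < p" for j
    proof -
      have "(u $ j)\<^sup>2 \<le> (\<Sum>i<p. (u $ i)\<^sup>2)" using that by (intro member_le_sum) auto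
      also have "\<dots> = 1" using vnorm_square[of u] u by simp
      finally show ?thesis by (simp add: abs_square_le_1)
    qed
    have "b\<^sup>2 = (\<Sum>l<n. (\<Sum>j<p. X $$ (l, j) * u $ j)\<^sup>2)"
      unfolding u(3) by (rule vnorm_mult_square[OF X u(1)])
    also have "\<dots> \<le> (\<Sum>l<n. (\<Sum>j<p. \<bar>X $$ (l, j)\<bar>)\<^sup>2)"
    proof (rule sum_mono)
      fix l
      have "\<bar>\<Sum>j<p. X $$ (l, j) * u $ j\<bar> \<le> (\<Sum>j<p. \<bar>X $$ (l, j)\<bar>)"
        by (rule order_trans[OF sum_abs sum_mono]) (use entry in \<open>auto simp: abs_mult mult_left_le\<close>)
      then show "(\<Sum>j<p. X $$ (l, j) * u $ j)\<^sup>2 \<le> (\<Sum>j<p. \<bar>X $$ (l, j)\<bar>)\<^sup>2"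
        by (rule power2_le_iff_abs_le[THEN iffD2, rotated]) (simp add: sum_nonneg)
    qed
    finally show "b \<le> sqrt (\<Sum>l<n. (\<Sum>j<p. \<bar>X $$ (l, j)\<bar>)\<^sup>2)" by (rule real_le_rsqrt)
  qed
qed

text \<open>Normalize \<open>w\<close> to a unit vector and use homogeneity; \<open>w = 0\<close> is
  separate.\<close>

lemma op_norm_bound:
  assumes X: "X \<in> carrier_mat n p"
  shows "(\<Sum>l<n. (\<Sum>j<p. X $$ (l, j) * w j)\<^sup>2) \<le> (op_norm X)\<^sup>2 * (\<Sum>j<p. (w j)\<^sup>2)"
proof (cases "(\<Sum>j<p. (w j)\<^sup>2) = 0")
  case True
  then have "\<forall>j<p. w j = 0" by (simp add: sum_nonneg_eq_0_iff)
  then show ?thesis by simp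
next
  case False
  define s where "s = sqrt (\<Sum>j<p. (w j)\<^sup>2)"
  have s2: "s\<^sup>2 = (\<Sum>j<p. (w j)\<^sup>2)" by (simp add: s_def sum_nonneg)
  have sp: "s > 0" using False by (simp add: s_def sum_nonneg less_le)
  define v where "v = vec p (\<lambda>j. w j / s)"
  have v: "v \<in> carrier_vec p" by (simp add: v_def)
  have "(vnorm v)\<^sup>2 = 1"
    unfolding vnorm_square using sp by (simp add: v_def power_divide sum_divide_distrib[symmetric] s2[symmetric])
  then have "vnorm v = 1" using vnorm_nonneg[of v] by (simp add: power2_eq_1_iff)
  then have "(vnorm (X *\<^sub>v v))\<^sup>2 \<le> (op_norm X)\<^sup>2"
    using vnorm_mult_le_op_norm[OF X v] vnorm_nonneg by (intro power_mono) auto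
  moreover have "(vnorm (X *\<^sub>v v))\<^sup>2 = (\<Sum>l<n. (\<Sum>j<p. X $$ (l, j) * w j)\<^sup>2) / s\<^sup>2"
  proof -
    have "(\<Sum>j<p. X $$ (l, j) * v $ j) = (\<Sum>j<p. X $$ (l, j) * w j) / s" for l
      by (simp add: v_def sum_divide_distrib)
    then show ?thesis
      unfolding vnorm_mult_square[OF X v] by (simp add: power_divide sum_divide_distrib[symmetric])
  qed
  ultimately show ?thesis using sp by (simp add: s2[symmetric] pos_divide_le_eq)
qed

text \<open>Evaluation at a unit coordinate vector. For unit columns this keeps the operator norm
  away from 0.\<close>

lemma op_norm_ge_col:
  assumes X: "X \<in> carrier_mat n p" and j: "j < p"
  shows "vnorm (col X j) \<le> op_norm X"
proof -
  have "(vnorm (unit_vec p j))\<^sup>2 = 1"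
    using j unfolding vnorm_square by (simp add: unit_vec_def sum.If_cases if_distrib[of "\<lambda>x. x\<^sup>2"])
  then have "vnorm (unit_vec p j) = 1" using vnorm_nonneg[of "unit_vec p j"] by (simp add: power2_eq_1_iff)
  moreover have "X *\<^sub>v unit_vec p j = col X j" using X j by (intro eq_vecI) auto
  ultimately show ?thesis using vnorm_mult_le_op_norm[OF X, of "unit_vec p j"] by simp
qed

section \<open>Column submatrices and their eigenvalues\<close>

lemma bij_betw_pick: "finite T \<Longrightarrow> bij_betw (pick T) {..<card T} T"
proof (rule bij_betwI[where g = "\<lambda>i. card {a\<in>T. a < i}"])
  assume fin: "finite T"
  show "(\<lambda>i. card {a \<in> T. a < i}) \<in> T \<rightarrow> {..<card T}"
    using fin by (auto intro!: psubset_card_mono)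
qed (auto simp: pick_in_set_le card_pick_le pick_card_in_set)

lemma col_submatrix_carrier:
  assumes X: "X \<in> carrier_mat n p" and T: "T \<subseteq> {0..<p}"
  shows "col_submatrix X T \<in> carrier_mat n (card T)"
proof -
  have "{j. j < p \<and> j \<in> T} = T" using T by auto
  then show ?thesis using X by (intro carrier_matI) (auto simp: col_submatrix_def dim_submatrix)
qed

lemma col_submatrix_index:
  assumes X: "X \<in> carrier_mat n p" and T: "T \<subseteq> {0..<p}" and "l < n" "a < card T"
  shows "col_submatrix X T $$ (l, a) = X $$ (l, pick T a)"
proof -
  have "{j. j < p \<and> j \<in> T} = T" using T by auto
  then show ?thesis
    using assms submatrix_index[of l X UNIV a T] by (simp add: col_submatrix_def pick_UNIV)
qed

text \<open>Rayleigh quotient: an eigenvector \<open>v\<close> satisfies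
  \<open>|Y v|^2 = k |v|^2\<close>, and both sides are rewritten as sums over
  \<open>T\<close>.\<close>

lemma col_submatrix_eigenvalue_bounds:
  assumes X: "X \<in> carrier_mat n p" and T: "T \<subseteq> {0..<p}" "card T > 0"
    and lo: "\<And>x. c * (\<Sum>i\<in>T. (x i)\<^sup>2) \<le> (\<Sum>l<n. (\<Sum>k\<in>T. X $$ (l, k) * x k)\<^sup>2)"
    and hi: "\<And>x. (\<Sum>l<n. (\<Sum>k\<in>T. X $$ (l, k) * x k)\<^sup>2) \<le> d * (\<Sum>i\<in>T. (x i)\<^sup>2)"
    and ev: "eigenvalue ((col_submatrix X T)\<^sup>T * col_submatrix X T) k"
  shows "c \<le> k \<and> k \<le> d"
proof -
  let ?Y = "col_submatrix X T"
  let ?m = "card T"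
  have Y: "?Y \<in> carrier_mat n ?m" by (rule col_submatrix_carrier[OF X T(1)])
  have fin: "finite T" using T finite_subset by auto
  obtain v where v: "v \<in> carrier_vec ?m" "v \<noteq> 0\<^sub>v ?m" "(?Y\<^sup>T * ?Y) *\<^sub>v v = k \<cdot>\<^sub>v v"
    using ev Y by (auto simp: eigenvalue_def eigenvector_def)
  \<comment> \<open>Moves \<open>v\<close> from positions in the submatrix to column indices: the
    position of \<open>i\<close> is the number of smaller elements of \<open>T\<close>.\<close>
  define x where "x i = v $ card {a\<in>T. a < i}" for i
  have xp: "x (pick T a) = v $ a" if "a < ?m" for a using that by (simp add: x_def card_pick_le)
  have sq: "(\<Sum>i\<in>T. (x i)\<^sup>2) = (vnorm v)\<^sup>2"
    using sum.reindex_bij_betw[OF bij_betw_pick[OF fin], of "\<lambda>i. (x i)\<^sup>2"] v(1)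
    by (simp add: vnorm_square xp)
  have "(\<Sum>j\<in>T. X $$ (l, j) * x j) = (\<Sum>a<?m. ?Y $$ (l, a) * v $ a)" if "l < n" for l
    using sum.reindex_bij_betw[OF bij_betw_pick[OF fin], of "\<lambda>j. X $$ (l, j) * x j"] that
    by (simp add: xp col_submatrix_index[OF X T(1)])
  then have "(\<Sum>l<n. (\<Sum>j\<in>T. X $$ (l, j) * x j)\<^sup>2) = (vnorm (?Y *\<^sub>v v))\<^sup>2"
    by (simp add: vnorm_mult_square[OF Y v(1)])
  also have "\<dots> = (?Y *\<^sub>v v) \<bullet> (?Y *\<^sub>v v)"
    by (rule vnorm_square_scalar_prod)
  also have "\<dots> = (?Y\<^sup>T *\<^sub>v (?Y *\<^sub>v v)) \<bullet> v"
    using transpose_vec_mult_scalar[OF Y v(1), of "?Y *\<^sub>v v"] Y v(1) by simp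
  also have "?Y\<^sup>T *\<^sub>v (?Y *\<^sub>v v) = k \<cdot>\<^sub>v v"
    using v Y by (metis assoc_mult_mat_vec transpose_carrier_mat)
  also have "(k \<cdot>\<^sub>v v) \<bullet> v = k * (vnorm v)\<^sup>2"
    using v(1) by (simp add: vnorm_square_scalar_prod)
  finally have q: "(\<Sum>l<n. (\<Sum>j\<in>T. X $$ (l, j) * x j)\<^sup>2) = k * (vnorm v)\<^sup>2" .
  have "(vnorm v)\<^sup>2 \<noteq> 0"
  proof
    assume "(vnorm v)\<^sup>2 = 0"
    then have "\<forall>i<?m. v $ i = 0" using v(1) unfolding vnorm_square by (simp add: sum_nonneg_eq_0_iff)
    then have "v = 0\<^sub>v ?m" using v(1) by (intro eq_vecI) auto
    then show False using v by simp
  qed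
  then have "(vnorm v)\<^sup>2 > 0" by simp
  then show ?thesis using lo[of x] hi[of x] unfolding q sq by simp
qed

theorem mainTheorem1:
  fixes X :: "real mat" and n p R :: nat and \<epsilon> :: real
  assumes "X \<in> carrier_mat n p"
    and "p > 0"
    and "\<forall>j<p. vnorm (col X j) = 1"
    and "0 < \<epsilon>" and "\<epsilon> < 1"
    and "R > 0"
    and "real R * ln (real R) \<le> \<epsilon>\<^sup>2 / (4 * (1 + \<epsilon>)) * (real p / (op_norm X)\<^sup>2)"
  shows "\<exists>T. T \<subseteq> {0..<p} \<and> card T \<ge> R \<and>
           1 - \<epsilon> \<le> lambda_min ((col_submatrix X T)\<^sup>T * col_submatrix X T) \<and>
           lambda_min ((col_submatrix X T)\<^sup>T * col_submatrix X T)
             \<le> lambda_max ((col_submatrix X T)\<^sup>T * col_submatrix X T) \<and>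
           lambda_max ((col_submatrix X T)\<^sup>T * col_submatrix X T) \<le> 1 + \<epsilon>"
proof -
  note X = assms(1)
  \<comment> \<open>Excludes division by zero in the size hypothesis.\<close>
  have "1 \<le> op_norm X" using op_norm_ge_col[OF X assms(2)] assms(2,3) by auto
  then have N: "0 < (op_norm X)\<^sup>2" by simp
  have unit: "(\<Sum>l<n. (X $$ (l, j))\<^sup>2) = 1" if "j \<in> {..<p}" for j
  proof -
    have "vnorm (col X j) = 1" using assms(3) that by simp
    then have "(\<Sum>l<n. (col X j $ l)\<^sup>2) = 1" using vnorm_square[of "col X j"] X by simp
    then show ?thesis using X that by simp
  qed
  have size: "real R * ln (real R) \<le> \<epsilon>\<^sup>2 / (4 * (1 + \<epsilon>)) * (real (card {..<p}) / (op_norm X)\<^sup>2)"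
    using assms(7) by simp
  have ne: "{..<p} \<noteq> {}" using assms(2) by auto
  obtain T where T: "T \<subseteq> {..<p}" "card T = R"
    and lo: "\<And>x. (1 - \<epsilon>) * (\<Sum>i\<in>T. (x i)\<^sup>2) \<le> (\<Sum>l<n. (\<Sum>k\<in>T. X $$ (l, k) * x k)\<^sup>2)"
    and hi: "\<And>x. (\<Sum>l<n. (\<Sum>k\<in>T. X $$ (l, k) * x k)\<^sup>2) \<le> (1 + \<epsilon>) * (\<Sum>i\<in>T. (x i)\<^sup>2)"
    using gram_column_selection[OF finite_lessThan ne unit N op_norm_bound[OF X] assms(4-6) size] by blast
  have T': "T \<subseteq> {0..<p}" using T by auto
  let ?A = "(col_submatrix X T)\<^sup>T * col_submatrix X T"
  have Y: "col_submatrix X T \<in> carrier_mat n R" using col_submatrix_carrier[OF X T'] T by simp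
  then have A: "?A \<in> carrier_mat R R" by simp
  have "?A\<^sup>T = ?A" using Y transpose_mult[of "(col_submatrix X T)\<^sup>T" R n "col_submatrix X T" R] by simp
  \<comment> \<open>Nonemptiness and finiteness of this set give \<open>Min\<close> and
    \<open>Max\<close> their meaning; \<open>R > 0\<close> makes the Gram matrix nonempty.\<close>
  then have ne: "{k. eigenvalue ?A k} \<noteq> {}"
    using symmetric_real_eigenvalue_exists[OF A assms(6)] by auto
  have fin: "finite {k. eigenvalue ?A k}" by (rule finite_eigenvalues[OF A])
  have bounds: "1 - \<epsilon> \<le> k \<and> k \<le> 1 + \<epsilon>" if "eigenvalue ?A k" for k
    using col_submatrix_eigenvalue_bounds[OF X T' _ lo hi that] T assms(6) by simp
  have "1 - \<epsilon> \<le> lambda_min ?A" "lambda_max ?A \<le> 1 + \<epsilon>" "lambda_min ?A \<le> lambda_max ?A"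
    unfolding lambda_min_def lambda_max_def using fin ne bounds Min_le_iff[OF fin ne] by (auto intro: Max_ge)
  then show ?thesis using T T' by auto
qed

end
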